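(* Let $N>Q\ge 1$, $M\ge 1$, $\mathbf Y\in\mathbb R^{N\times M}$, and for $\mathbf X\in\mathbb R^{N\times Q}$, $\sigma^2>0$ let $$L(\mathbf X,\sigma^2)=\sum_{j=1}^M\log\mathcal N\big(\mathbf y_{:,j}\mid \mathbf 0,\ \mathbf X\mathbf X^\top+\sigma^2\mathbf I_N\big).$$ Consider stationary points $\hat{\mathbf X}=\mathbf U_Q(\boldsymbol\Lambda_Q-\sigma^2\mathbf I_Q)^{1/2}\mathbf R$ of $\mathbf X\mapsto L(\mathbf X,\sigma^2)$, with $Q'$ retained eigenvalues $\lambda_1,\dots,\lambda_{Q'}$ and discarded eigenvalues $\lambda_{Q'+1},\dots,\lambda_N$ of $\frac1M\mathbf Y\mathbf Y^\top$ (see context), in the case that $\sigma^2>0$ equals its maximum likelihood estimator $$\sigma^2=\hat\sigma^2=\frac{1}{N-Q'}\sum_{j=Q'+1}^{N}\lambda_j .$$ Then the only stable maximum is the global optimum: every such stationary point $(\hat{\mathbf X},\hat\sigma^2)$ is either a saddle point of $L$ or a global maximizer of $L$ over $\mathbb R^{N\times Q}\times(0,\infty)$; no local maximum other than the global one exists.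
   Context: $\mathcal N(\mathbf y\mid\mathbf 0,\mathbf K)$ is the Gaussian density with mean $\mathbf 0$ and covariance $\mathbf K$; $\mathbf y_{:,j}\in\mathbb R^N$ is the $j$-th column of $\mathbf Y$. $L$ is the log marginal likelihood of the linear Gaussian process latent variable model (inner product kernel $k(\mathbf x,\mathbf x')=\mathbf x^\top\mathbf x'$), and $\sigma^2$ is the projection variance. For fixed $\sigma^2>0$, the stationary points of $\mathbf X\mapsto L(\mathbf X,\sigma^2)$ are exactly the matrices $\hat{\mathbf X}=\mathbf U_Q(\boldsymbol\Lambda_Q-\sigma^2\mathbf I_Q)^{1/2}\mathbf R$, where $\mathbf U_Q=[\mathbf u_1,\dots,\mathbf u_Q]\in\mathbb R^{N\times Q}$ has as columns orthonormal eigenvectors of $\frac1M\mathbf Y\mathbf Y^\top$ (any choice), $\mathbf R\in\mathbb R^{Q\times Q}$ is an arbitrary orthogonal matrix, and $\boldsymbol\Lambda_Q$ is diagonal with each $[\boldsymbol\Lambda_Q]_{i,i}$ equal either to the eigenvalue of $\mathbf u_i$ (allowed when that eigenvalue exceeds $\sigma^2$; such an eigenvalue is called retained) or to $\sigma^2$. $Q'$ is the number of retained eigenvalues, i.e. of indices $i$ with $[\boldsymbol\Lambda_Q]_{i,i}\ne\sigma^2$. The $N-Q'$ remaining eigenvalues of $\frac1M\mathbf Y\mathbf Y^\top$ (with multiplicity) are the discarded ones; the eigenvalues are labelled so that $\lambda_1,\dots,\lambda_{Q'}$ are retained and $\lambda_{Q'+1},\dots,\lambda_N$ are discarded. A "stable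 maximum" is a stationary point that is a local maximum; saddle points are regarded as unstable. A saddle point is a stationary point that is neither a local maximum nor a local minimum. *)

theory Defs
  imports "HOL-Analysis.Analysis"
begin

definition gaussian_density :: "real^'n \<Rightarrow> real^'n^'n \<Rightarrow> real^'n \<Rightarrow> real" where
  "gaussian_density m K y =
     exp (- ((y - m) \<bullet> (matrix_inv K *v (y - m))) / 2) / sqrt ((2 * pi) ^ CARD('n) * det K)"

text \<open>In \<^typ>\<open>real^'m^'n\<close> the outer index \<^typ>\<open>'n\<close> counts rows, and \<^term>\<open>mat s\<close> is
  \<open>s\<close> times the identity matrix.\<close>

definition log_marginal :: "real^'m^'n \<Rightarrow> real^'q^'n \<Rightarrow> real \<Rightarrow> real" where
  "log_marginal Y X s =
     (\<Sum>j\<in>UNIV. ln (gaussian_density 0 (X ** transpose X + mat s) (column j Y)))"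

definition sample_cov :: "real^'m^'n \<Rightarrow> real^'n^'n" where
  "sample_cov Y = (1 / real CARD('m)) *\<^sub>R (Y ** transpose Y)"

definition diag_matrix :: "('q \<Rightarrow> real) \<Rightarrow> real^'q^'q" where
  "diag_matrix d = (\<chi> i j. if i = j then d i else 0)"

text \<open>\<open>\<nu> 1, \<dots>, \<nu> N\<close> are the eigenvalues of \<open>A\<close> repeated according to their multiplicity as roots
  of the characteristic polynomial; values of \<open>\<nu>\<close> outside \<open>{1..N}\<close> are irrelevant.\<close>

definition lists_eigenvalues :: "real^'n^'n \<Rightarrow> (nat \<Rightarrow> real) \<Rightarrow> bool" where
  "lists_eigenvalues A \<nu> \<longleftrightarrow> (\<forall>x. det (mat x - A) = (\<Prod>k=1..CARD('n). x - \<nu> k))"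

text \<open>\<open>X = U (\<Lambda> - s I)\<^sup>1\<^sup>/\<^sup>2 R\<close>, where \<open>\<Lambda>\<close> has diagonal \<open>l\<close>, the columns of \<open>U\<close> are orthonormal
  eigenvectors of the sample covariance with eigenvalues \<open>\<mu>\<close>, and \<open>R\<close> is orthogonal.\<close>

definition stationary_form ::
    "real^'m^'n \<Rightarrow> real \<Rightarrow> real^'q^'n \<Rightarrow> ('q \<Rightarrow> real) \<Rightarrow> ('q \<Rightarrow> real) \<Rightarrow> real^'q^'q \<Rightarrow> real^'q^'n \<Rightarrow> bool"
  where
  "stationary_form Y s U \<mu> l R X \<longleftrightarrow>
     transpose U ** U = mat 1 \<and>
     (\<forall>i. sample_cov Y *v column i U = \<mu> i *\<^sub>R column i U) \<and>
     (\<forall>i. (l i = \<mu> i \<and> \<mu> i > s) \<or> l i = s) \<and>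
     orthogonal_matrix R \<and>
     X = U ** diag_matrix (\<lambda>i. sqrt (l i - s)) ** R"

definition retained :: "real \<Rightarrow> ('q::finite \<Rightarrow> real) \<Rightarrow> 'q set" where
  "retained s l = {i. l i \<noteq> s}"

text \<open>The bijection \<open>\<pi>\<close> expresses that the eigenvalues are labelled so that the first
  \<open>Q' = card (retained s l)\<close> of them are, with multiplicity, the retained ones.\<close>

definition ml_stationary_point :: "real^'m^'n \<Rightarrow> real^'q^'n \<Rightarrow> real \<Rightarrow> bool" where
  "ml_stationary_point Y X s \<longleftrightarrow> s > 0 \<and>
     (\<exists>U \<mu> l R \<nu> \<pi>.
        stationary_form Y s U \<mu> l R X \<and>
        lists_eigenvalues (sample_cov Y) \<nu> \<and>
        bij_betw \<pi> (retained s l) {1..card (retained s l)} \<and>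
        (\<forall>i\<in>retained s l. \<nu> (\<pi> i) = l i) \<and>
        s = (\<Sum>j = card (retained s l) + 1..CARD('n). \<nu> j) / real (CARD('n) - card (retained s l)))"

definition local_max :: "('a::topological_space \<Rightarrow> real) \<Rightarrow> 'a \<Rightarrow> bool" where
  "local_max f p \<longleftrightarrow> (\<forall>\<^sub>F x in nhds p. f x \<le> f p)"

definition local_min :: "('a::topological_space \<Rightarrow> real) \<Rightarrow> 'a \<Rightarrow> bool" where
  "local_min f p \<longleftrightarrow> (\<forall>\<^sub>F x in nhds p. f p \<le> f x)"

definition stationary_point :: "('a::real_normed_vector \<Rightarrow> real) \<Rightarrow> 'a \<Rightarrow> bool" where
  "stationary_point f p \<longleftrightarrow> (f has_derivative (\<lambda>_. 0)) (at p)"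

definition saddle_point :: "('a::real_normed_vector \<Rightarrow> real) \<Rightarrow> 'a \<Rightarrow> bool" where
  "saddle_point f p \<longleftrightarrow> stationary_point f p \<and> \<not> local_max f p \<and> \<not> local_min f p"

text \<open>Since \<open>s > 0\<close> is an open condition, local notions for the joint function
  \<open>(X, s) \<mapsto> log_marginal Y X s\<close> at a point with \<open>s > 0\<close> do not see its values at \<open>s \<le> 0\<close>;
  the global one has to exclude them explicitly.\<close>

definition global_max :: "real^'m^'n \<Rightarrow> real^'q^'n \<Rightarrow> real \<Rightarrow> bool" where
  "global_max Y X s \<longleftrightarrow>
     s > 0 \<and> (\<forall>X' s'. s' > 0 \<longrightarrow> log_marginal Y (X' :: real^'q^'n) s' \<le> log_marginal Y X s)"

end

(* Write S for the sample covariance and K = X X^T + s I. Up to constants -L is the cost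
   F = ln det K + tr(K^-1 S), and its gradient with respect to K is W = K^-1 (K - S) K^-1. The point
   (X, s) is stationary iff W X = 0 and tr W = 0, which amounts to S X = K X and tr S = tr K; the
   parametrised stationary points with the maximum likelihood value of s satisfy these two equations.

   At such a point F, as a function of s alone, has a strict minimum, so (X, s) is never a local
   minimum of L. If it is a local maximum in X, then rotating an eigenvector of K from the range of X
   towards its orthogonal complement, or, when X is rank deficient, adding a rank one term, shows
   that S restricted to the complement is bounded by every retained eigenvalue, respectively by s. A
   trace inequality of von Neumann type, proved by linear programming duality on the doubly
   stochastic matrix of squared overlaps of two eigenbases, then gives F(K') >= ln det K + N = F(K). *)

theory Submission
  imports Defs
begin

section \<open>Orthonormal eigenbases of symmetric matrices\<close>

text \<open>The obstacle is that local maximality bounds \<open>S\<close> on the complement of the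
  range of \<open>X\<close> only by a single number \<open>\<kappa>\<close>. This is enough because
  \<open>K'^-1 = I/s' - B\<close> with \<open>B\<close> positive semidefinite of rank at most Q, so
  that \<open>tr (K'^-1 S) = tr S / s' - tr (B S)\<close>. The first term involves only
  \<open>tr S = tr K\<close>. In the second, \<open>S\<close> may be replaced by the larger form
  \<open>\<kappa> I + sum_j max (k_j - \<kappa>, 0) f_j f_j^T\<close>, which is diagonal in the
  eigenbasis of \<open>K\<close>. When both spectra are paired in decreasing order, only the Q
  largest eigenvalues of this form meet a nonzero eigenvalue of \<open>B\<close>, and these are the
  Q largest eigenvalues of \<open>K\<close>: retained ones, at least \<open>\<kappa>\<close>, if
  \<open>X\<close> has full rank, and untouched if \<open>\<kappa> = s\<close>. What remains is a
  sum of terms \<open>ln l_m + k_m / l_m\<close>, each at least \<open>ln k_m + 1\<close>. The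
  gradient is found indirectly: Cramer's rule gives differentiability, and comparison with explicit
  functions that touch at the point identifies the derivative.\<close>

lemma symmetric_dot:
  fixes A :: "real^'n^'n"
  assumes "transpose A = A"
  shows "(A *v x) \<bullet> y = x \<bullet> (A *v y)"
  by (metis assms dot_lmul_matrix vector_transpose_matrix)

lemma mat_mult_vector: "mat t *v x = t *\<^sub>R (x :: real^'n)"
  by (simp add: vec_eq_iff matrix_vector_mult_def mat_def if_distrib[where f="\<lambda>z. z * _"] cong: if_cong)

text \<open>Because the orthonormal family is indexed by the coordinate type, it is automatically a
  basis, and \<open>k\<close> lists the eigenvalues of \<open>A\<close> with multiplicity.\<close>

definition eigenbasis :: "real^'n^'n \<Rightarrow> ('n \<Rightarrow> real^'n) \<Rightarrow> ('n \<Rightarrow> real) \<Rightarrow> bool" where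
  "eigenbasis A e k \<longleftrightarrow> (\<forall>i j. e i \<bullet> e j = (if i = j then 1 else 0)) \<and> (\<forall>i. A *v e i = k i *\<^sub>R e i)"

lemma nonpos_quadratic_imp_zero:
  fixes a c :: real
  assumes "\<And>t. 2 * t * a + t\<^sup>2 * c \<le> 0"
  shows "a = 0"
proof (rule ccontr)
  assume a: "a \<noteq> 0"
  \<comment> \<open>With this choice the quadratic term is at most \<open>t * a\<close> in absolute
    value, half of the linear term.\<close>
  define t where "t = a / (\<bar>c\<bar> + 1)"
  have "t\<^sup>2 * \<bar>c\<bar> \<le> t\<^sup>2 * (\<bar>c\<bar> + 1)" by (simp add: mult_left_mono)
  also have "\<dots> = t * a" by (simp add: t_def power2_eq_square)
  finally have "t\<^sup>2 * \<bar>c\<bar> \<le> t * a" .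
  moreover have "- (t\<^sup>2 * \<bar>c\<bar>) \<le> t\<^sup>2 * c"
    by (metis abs_ge_minus_self minus_le_iff mult_left_mono mult_minus_right zero_le_power2)
  moreover have "t * a > 0"
    using a by (simp add: t_def power2_eq_square[symmetric] add_nonneg_pos)
  ultimately show False using assms[of t] by linarith
qed

text \<open>Maximise the Rayleigh quotient on the unit sphere of the orthogonal complement of
  \<open>B\<close>. The complement is nontrivial by the cardinality bound and invariant under
  \<open>A\<close> by symmetry; a maximiser is an eigenvector because its first variation vanishes
  in every admissible direction orthogonal to it.\<close>

lemma eigenvector_orthogonal_to:
  fixes A :: "real^'n^'n"
  assumes sym: "transpose A = A" and card: "card B < CARD('n)" and fin: "finite B"
    and eig: "\<And>b. b \<in> B \<Longrightarrow> \<exists>l. A *v b = l *\<^sub>R b"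
  obtains v l where "norm v = 1" "A *v v = l *\<^sub>R v" "\<And>b. b \<in> B \<Longrightarrow> b \<bullet> v = 0"
proof -
  define T where "T = {x. \<forall>b\<in>B. b \<bullet> x = 0}"
  have subT: "subspace T"
    unfolding T_def subspace_def by (auto simp: inner_add_right)
  have AT: "A *v x \<in> T" if "x \<in> T" for x
  proof -
    have "b \<bullet> (A *v x) = 0" if b: "b \<in> B" for b
    proof -
      obtain l where "A *v b = l *\<^sub>R b" using eig b by blast
      then show ?thesis using \<open>x \<in> T\<close> b symmetric_dot[OF sym, of b x] by (simp add: T_def)
    qed
    then show ?thesis by (simp add: T_def)
  qed
  have "dim B \<le> card B" using dim_le_card' fin by blast
  then have "dim B < DIM(real^'n)" using card by simp
  then have "span B \<noteq> UNIV" using dim_span by (metis dim_UNIV nat_less_le)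
  then obtain y where y: "y \<noteq> 0" "\<And>x. x \<in> span B \<Longrightarrow> orthogonal y x"
    using \<open>dim B < DIM(real^'n)\<close> orthogonal_to_subspace_exists by metis
  have yT: "y \<in> T" using y(2) by (auto simp: T_def orthogonal_def inner_commute span_base)
  define C where "C = sphere 0 1 \<inter> T"
  have "compact C" unfolding C_def using closed_subspace[OF subT] by (simp add: compact_Int_closed)
  moreover have "inverse (norm y) *\<^sub>R y \<in> C"
    using y(1) yT subT by (simp add: C_def subspace_mul)
  then have "C \<noteq> {}" by blast
  moreover have "continuous_on C (\<lambda>x. x \<bullet> (A *v x))"
    by (intro continuous_intros linear_continuous_on matrix_vector_mul_bounded_linear)
  ultimately obtain v where v: "v \<in> C" "\<And>x. x \<in> C \<Longrightarrow> x \<bullet> (A *v x) \<le> v \<bullet> (A *v v)"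
    using continuous_attains_sup by metis
  define l where "l = v \<bullet> (A *v v)"
  have nv: "norm v = 1" "v \<in> T" using v(1) by (auto simp: C_def)
  have vv: "v \<bullet> v = 1" using nv by (simp add: dot_square_norm)
  have max: "x \<bullet> (A *v x) \<le> l * (x \<bullet> x)" if "x \<in> T" for x
  proof (cases "x = 0")
    case False
    then have "inverse (norm x) *\<^sub>R x \<in> C" using that subT by (simp add: C_def subspace_mul)
    from v(2)[OF this] show ?thesis
      using False by (simp add: l_def[symmetric] matrix_vector_mult_scaleR dot_square_norm
          field_simps power2_eq_square)
  qed simp
  have cross: "v \<bullet> (A *v w) = 0" if w: "w \<in> T" "v \<bullet> w = 0" for w
  proof (rule nonpos_quadratic_imp_zero)
    fix t
    have "v + t *\<^sub>R w \<in> T" using nv(2) w(1) subT by (simp add: subspace_add subspace_mul)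
    from max[OF this] have "(v + t *\<^sub>R w) \<bullet> (A *v (v + t *\<^sub>R w)) \<le> l * (1 + t\<^sup>2 * (w \<bullet> w))"
      using w(2) vv by (simp add: inner_add_left inner_add_right inner_commute power2_eq_square mult.assoc)
    moreover have "w \<bullet> (A *v v) = v \<bullet> (A *v w)"
      using symmetric_dot[OF sym, of w v] by (simp add: inner_commute)
    ultimately show "2 * t * (v \<bullet> (A *v w)) + t\<^sup>2 * (w \<bullet> (A *v w) - l * (w \<bullet> w)) \<le> 0"
      by (simp add: matrix_vector_right_distrib matrix_vector_mult_scaleR inner_add_left
          inner_add_right l_def[symmetric] power2_eq_square algebra_simps)
  qed
  \<comment> \<open>The residual of the eigenvalue equation is itself an admissible direction, so
    \<open>cross\<close> forces \<open>r \<bullet> r = 0\<close>.\<close>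
  define r where "r = A *v v - l *\<^sub>R v"
  have rT: "r \<in> T" unfolding r_def using AT nv(2) subT by (simp add: subspace_diff subspace_mul)
  have vr: "v \<bullet> r = 0" by (simp add: r_def inner_diff_right l_def[symmetric] vv)
  have "r \<bullet> r = r \<bullet> (A *v v)" using vr by (simp add: r_def inner_diff_right inner_commute)
  also have "\<dots> = v \<bullet> (A *v r)" using symmetric_dot[OF sym, of r v] by (simp add: inner_commute)
  also have "\<dots> = 0" by (rule cross[OF rT vr])
  finally have "A *v v = l *\<^sub>R v" by (simp add: r_def)
  with nv show ?thesis by (intro that) (auto simp: T_def)
qed

theorem symmetric_eigenbasis:
  fixes A :: "real^'n^'n"
  assumes sym: "transpose A = A"
  obtains e k where "eigenbasis A e k"
proof -
  have "\<exists>B. finite B \<and> card B = m \<and> (\<forall>b\<in>B. \<forall>c\<in>B. b \<bullet> c = (if b = c then 1 else 0))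
      \<and> (\<forall>b\<in>B. \<exists>l. A *v b = l *\<^sub>R b)" if "m \<le> CARD('n)" for m
    using that
  proof (induction m)
    case 0
    then show ?case by (intro exI[of _ "{}"]) auto
  next
    case (Suc m)
    then obtain B where B: "finite B" "card B = m"
      "\<forall>b\<in>B. \<forall>c\<in>B. b \<bullet> c = (if b = c then 1 else 0)" "\<forall>b\<in>B. \<exists>l. A *v b = l *\<^sub>R b" by auto
    then obtain v l where v: "norm v = 1" "A *v v = l *\<^sub>R v" "\<And>b. b \<in> B \<Longrightarrow> b \<bullet> v = 0"
      using eigenvector_orthogonal_to[OF sym, of B] Suc.prems by (metis Suc_le_lessD)
    have "v \<bullet> v = 1" using v(1) by (simp add: dot_square_norm)
    then have "v \<notin> B" using v(3) by force
    then show ?case using B v \<open>v \<bullet> v = 1\<close>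
      by (intro exI[of _ "insert v B"]) (auto simp: inner_commute)
  qed
  from this[of "CARD('n)"] obtain B where B: "finite B" "card B = CARD('n)"
    "\<forall>b\<in>B. \<forall>c\<in>B. b \<bullet> c = (if b = c then 1 else 0)" "\<forall>b\<in>B. \<exists>l. A *v b = l *\<^sub>R b" by auto
  then obtain e where e: "bij_betw e (UNIV :: 'n set) B"
    using finite_same_card_bij[of "UNIV :: 'n set" B] by auto
  then have eB: "e i \<in> B" for i by (auto simp: bij_betw_def)
  have inj: "e i = e j \<longleftrightarrow> i = j" for i j using e by (auto simp: bij_betw_def inj_on_def)
  have "\<forall>i. \<exists>l. A *v e i = l *\<^sub>R e i" using B(4) eB by blast
  from choice[OF this] obtain k where "\<forall>i. A *v e i = k i *\<^sub>R e i" by blast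
  then have "eigenbasis A e k" using B(3) eB inj by (simp add: eigenbasis_def)
  then show ?thesis by (rule that)
qed

lemma eigenbasis_inner: "eigenbasis A e k \<Longrightarrow> e i \<bullet> e j = (if i = j then 1 else 0)"
  by (simp add: eigenbasis_def)

lemma eigenbasis_mult: "eigenbasis A e k \<Longrightarrow> A *v e i = k i *\<^sub>R e i"
  by (simp add: eigenbasis_def)

lemma eigenbasis_matrix:
  assumes "eigenbasis A e k"
  defines "P \<equiv> (\<chi> i j. e j $ i)"
  shows "transpose P ** P = mat 1" "P ** transpose P = mat 1" "A ** P = P ** diag_matrix k"
proof -
  show 1: "transpose P ** P = mat 1"
    using eigenbasis_inner[OF assms(1)]
    by (simp add: P_def matrix_mult_transpose_dot_column column_def mat_def vec_eq_iff vec_lambda_eta)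
  then show "P ** transpose P = mat 1" by (simp add: matrix_left_right_inverse)
  show "A ** P = P ** diag_matrix k"
  proof (simp add: vec_eq_iff, intro allI)
    fix i j
    have "(A ** P) $ i $ j = (A *v e j) $ i"
      by (simp add: P_def matrix_matrix_mult_def matrix_vector_mult_def)
    also have "\<dots> = k j * e j $ i" using eigenbasis_mult[OF assms(1)] by simp
    also have "\<dots> = (P ** diag_matrix k) $ i $ j"
      by (simp add: P_def matrix_matrix_mult_def diag_matrix_def if_distrib cong: if_cong)
    finally show "(A ** P) $ i $ j = (P ** diag_matrix k) $ i $ j" .
  qed
qed

lemma eigenbasis_det:
  assumes "eigenbasis A e k"
  shows "det A = (\<Prod>i\<in>UNIV. k i)"
proof -
  define P where "P = (\<chi> i j. e j $ i)"
  note P = eigenbasis_matrix[OF assms, folded P_def]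
  have "det P * det P = 1" using arg_cong[OF P(1), of det] by (simp add: det_mul)
  moreover have "det A * det P = det P * det (diag_matrix k)"
    using arg_cong[OF P(3), of det] by (simp add: det_mul)
  ultimately have "det A = det (diag_matrix k)" by auto
  also have "\<dots> = (\<Prod>i\<in>UNIV. k i)" by (subst det_diagonal) (auto simp: diag_matrix_def)
  finally show ?thesis .
qed

lemma eigenbasis_trace:
  assumes "eigenbasis A e k"
  shows "trace B = (\<Sum>i\<in>UNIV. e i \<bullet> (B *v e i))"
proof -
  define P where "P = (\<chi> i j. e j $ i)"
  note P = eigenbasis_matrix[OF assms, folded P_def]
  have "trace B = trace (transpose P ** (B ** P))"
    by (metis P(2) matrix_mul_assoc matrix_mul_rid trace_mul_sym)
  also have "\<dots> = (\<Sum>i\<in>UNIV. e i \<bullet> (B *v e i))"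
    unfolding trace_def P_def
    by (simp add: matrix_matrix_mult_def matrix_vector_mult_def transpose_def inner_vec_def)
  finally show ?thesis .
qed

lemma eigenbasis_expand:
  assumes "eigenbasis A e k"
  shows "x = (\<Sum>i\<in>UNIV. (e i \<bullet> x) *\<^sub>R e i)"
proof -
  define P where "P = (\<chi> i j. e j $ i)"
  note P = eigenbasis_matrix[OF assms, folded P_def]
  have "x = P *v (transpose P *v x)" by (simp only: matrix_vector_mul_assoc P(2)) simp
  also have "\<dots> = (\<Sum>i\<in>UNIV. (e i \<bullet> x) *\<^sub>R e i)"
    by (simp add: vec_eq_iff P_def matrix_vector_mult_def vector_matrix_mult_def inner_vec_def
        transpose_def mult.commute)
  finally show ?thesis .
qed

lemma eigenbasis_parseval:
  assumes "eigenbasis A e k"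
  shows "x \<bullet> y = (\<Sum>i\<in>UNIV. (e i \<bullet> x) * (e i \<bullet> y))"
proof -
  have "x \<bullet> y = (\<Sum>i\<in>UNIV. (e i \<bullet> x) *\<^sub>R e i) \<bullet> y" using eigenbasis_expand[OF assms, of x] by simp
  then show ?thesis by (simp add: inner_sum_left)
qed

section \<open>Inverses, and eigenbases of inverses and shifts\<close>

lemma matrix_inv_unique:
  fixes A B :: "real^'n^'n"
  assumes "A ** B = mat 1"
  shows "matrix_inv A = B"
proof -
  have BA: "B ** A = mat 1" using assms matrix_left_right_inverse by blast
  have "A ** matrix_inv A = mat 1 \<and> matrix_inv A ** A = mat 1"
    unfolding matrix_inv_def by (rule someI[of _ B]) (use assms BA in auto)
  then show ?thesis by (metis BA matrix_mul_assoc matrix_mul_lid matrix_mul_rid)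
qed

lemma matrix_inv_mult:
  fixes A :: "real^'n^'n"
  assumes "det A \<noteq> 0"
  shows "A ** matrix_inv A = mat 1" "matrix_inv A ** A = mat 1"
proof -
  obtain B where "A ** B = mat 1" using assms invertible_det_nz[of A] invertible_def by blast
  then show "A ** matrix_inv A = mat 1" "matrix_inv A ** A = mat 1"
    using matrix_inv_unique matrix_left_right_inverse by blast+
qed

lemma matrix_inv_symmetric:
  fixes A :: "real^'n^'n"
  assumes "det A \<noteq> 0" "transpose A = A"
  shows "transpose (matrix_inv A) = matrix_inv A"
  by (metis assms matrix_inv_mult(2) matrix_inv_unique matrix_transpose_mul transpose_mat)

lemma eigenbasis_inv:
  assumes "eigenbasis A e k" "\<And>i. k i > 0"
  shows "eigenbasis (matrix_inv A) e (\<lambda>i. 1 / k i)"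
proof -
  have "det A \<noteq> 0" using eigenbasis_det[OF assms(1)] assms(2) by (simp add: less_imp_neq[symmetric])
  have "matrix_inv A *v e i = (1 / k i) *\<^sub>R e i" for i
  proof -
    have "e i = matrix_inv A *v (A *v e i)"
      using matrix_inv_mult(2)[OF \<open>det A \<noteq> 0\<close>] by (simp add: matrix_vector_mul_assoc)
    then have *: "e i = k i *\<^sub>R (matrix_inv A *v e i)"
      using eigenbasis_mult[OF assms(1)] by (simp add: matrix_vector_mult_scaleR)
    have "(1 / k i) *\<^sub>R e i = (1 / k i) *\<^sub>R (k i *\<^sub>R (matrix_inv A *v e i))" by (subst *) simp
    then show ?thesis using assms(2)[of i] by simp
  qed
  then show ?thesis using eigenbasis_inner[OF assms(1)] by (simp add: eigenbasis_def)
qed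

lemma eigenbasis_add_mat:
  assumes "eigenbasis A e k"
  shows "eigenbasis (a *\<^sub>R A + mat t) e (\<lambda>i. a * k i + t)"
  using assms
  by (simp add: eigenbasis_def matrix_vector_mult_add_rdistrib scaleR_add_left mat_mult_vector
      scaleR_matrix_vector_assoc[symmetric])

section \<open>Trace inequalities\<close>

lemma eigenbasis_overlap:
  assumes "eigenbasis A e k" "eigenbasis B f l"
  shows "(\<Sum>j\<in>UNIV. (f j \<bullet> e i)\<^sup>2) = 1" "(\<Sum>i\<in>UNIV. (f j \<bullet> e i)\<^sup>2) = 1"
  using eigenbasis_parseval[OF assms(2), of "e i" "e i"] eigenbasis_parseval[OF assms(1), of "f j" "f j"]
    eigenbasis_inner[OF assms(1), of i i] eigenbasis_inner[OF assms(2), of j j]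
  by (simp_all add: power2_eq_square inner_commute)

lemma eigenbasis_quadratic:
  assumes "eigenbasis B f l"
  shows "x \<bullet> (B *v x) = (\<Sum>j\<in>UNIV. l j * (f j \<bullet> x)\<^sup>2)"
proof -
  have "B *v x = B *v (\<Sum>j\<in>UNIV. (f j \<bullet> x) *\<^sub>R f j)" using eigenbasis_expand[OF assms, of x] by simp
  also have "\<dots> = (\<Sum>j\<in>UNIV. (f j \<bullet> x) *\<^sub>R (l j *\<^sub>R f j))"
    by (simp add: linear_sum[OF matrix_vector_mul_linear] matrix_vector_mult_scaleR
        eigenbasis_mult[OF assms])
  finally show ?thesis
    by (simp add: inner_sum_right power2_eq_square inner_commute mult_ac)
qed

lemma eigenbasis_trace_inv_mult:
  assumes "eigenbasis K e k" "\<And>i. k i > 0"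
  shows "trace (matrix_inv K ** S) = (\<Sum>i\<in>UNIV. (e i \<bullet> (S *v e i)) / k i)"
proof -
  have "trace (matrix_inv K ** S) = trace (S ** matrix_inv K)" by (rule trace_mul_sym)
  also have "\<dots> = (\<Sum>i\<in>UNIV. e i \<bullet> ((S ** matrix_inv K) *v e i))"
    by (rule eigenbasis_trace[OF assms(1)])
  also have "\<dots> = (\<Sum>i\<in>UNIV. (e i \<bullet> (S *v e i)) / k i)"
    using eigenbasis_mult[OF eigenbasis_inv[OF assms]]
    by (simp add: matrix_vector_mul_assoc[symmetric] matrix_vector_mult_scaleR)
  finally show ?thesis .
qed

lemma eigenbasis_ln_det:
  assumes "eigenbasis A e k" "\<And>i. k i > 0"
  shows "det A > 0" "ln (det A) = (\<Sum>i\<in>UNIV. ln (k i))"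
  using assms(2) by (simp_all add: eigenbasis_det[OF assms(1)] prod_pos ln_prod less_imp_neq[symmetric])

text \<open>This is \<open>ln z \<le> z - 1\<close> at \<open>z = y / x\<close>. It says that
  \<open>x = y\<close> minimises \<open>ln x + y / x\<close>, the scalar case of the cost.\<close>

lemma ln_add_div_ge:
  fixes x y :: real
  assumes "x > 0" "y > 0"
  shows "ln x + y / x \<ge> ln y + 1"
  using ln_le_minus_one[of "y / x"] assms by (simp add: ln_div)

lemma ln_add_div_gt:
  fixes x y :: real
  assumes "x > 0" "y > 0" "x \<noteq> y"
  shows "ln x + y / x > ln y + 1"
  using ln_eq_minus_one[of "y / x"] ln_add_div_ge[of x y] assms by (force simp: ln_div)

text \<open>Concavity of \<open>ln det\<close>, with the tangent taken at \<open>B\<close>. The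
  squared overlaps of the two eigenbases have row and column sums 1, so averaging
  \<open>ln_add_div_ge\<close> with these weights produces both matrix expressions.\<close>

lemma ln_det_tangent:
  fixes A B :: "real^'n^'n"
  assumes A: "eigenbasis A e a" "\<And>i. a i > 0" and B: "eigenbasis B f b" "\<And>i. b i > 0"
  shows "ln (det A) + real CARD('n) \<le> ln (det B) + trace (matrix_inv B ** A)"
proof -
  note D = eigenbasis_overlap[OF A(1) B(1)]
  have "ln (det A) + real CARD('n) = (\<Sum>j\<in>UNIV. ln (a j) + 1)"
    using A by (simp add: eigenbasis_ln_det sum.distrib)
  also have "\<dots> = (\<Sum>j\<in>UNIV. \<Sum>i\<in>UNIV. (f i \<bullet> e j)\<^sup>2 * (ln (a j) + 1))"
    by (simp add: sum_distrib_right[symmetric] D)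
  also have "\<dots> \<le> (\<Sum>j\<in>UNIV. \<Sum>i\<in>UNIV. (f i \<bullet> e j)\<^sup>2 * (ln (b i) + a j / b i))"
    using A(2) B(2) by (intro sum_mono mult_left_mono ln_add_div_ge) auto
  also have "\<dots> = (\<Sum>i\<in>UNIV. \<Sum>j\<in>UNIV. (f i \<bullet> e j)\<^sup>2 * (ln (b i) + a j / b i))"
    by (rule sum.swap)
  also have "\<dots> = (\<Sum>i\<in>UNIV. ln (b i) + (\<Sum>j\<in>UNIV. a j * (f i \<bullet> e j)\<^sup>2) / b i)"
  proof -
    have "(\<Sum>j\<in>UNIV. (f i \<bullet> e j)\<^sup>2 * (ln (b i) + a j / b i))
        = (\<Sum>j\<in>UNIV. (f i \<bullet> e j)\<^sup>2) * ln (b i) + (\<Sum>j\<in>UNIV. a j * (f i \<bullet> e j)\<^sup>2) / b i" for i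
      by (simp add: sum.distrib sum_distrib_left sum_distrib_right sum_divide_distrib algebra_simps)
    then show ?thesis by (simp add: D)
  qed
  also have "\<dots> = (\<Sum>i\<in>UNIV. ln (b i) + (f i \<bullet> (A *v f i)) / b i)"
    by (simp add: eigenbasis_quadratic[OF A(1)] inner_commute)
  also have "\<dots> = ln (det B) + trace (matrix_inv B ** A)"
    using B by (simp add: eigenbasis_ln_det sum.distrib eigenbasis_trace_inv_mult)
  finally show ?thesis .
qed

text \<open>Weak linear programming duality: nonnegative potentials that dominate every product
  \<open>b i * \<tau> j\<close> and are tight on the diagonal certify that the identity pairing is
  optimal.\<close>

lemma substochastic_rearrangement:
  fixes b \<tau> :: "nat \<Rightarrow> real"
  assumes b: "\<And>i j. i \<le> j \<Longrightarrow> j < n \<Longrightarrow> b j \<le> b i" "\<And>i. i < n \<Longrightarrow> 0 \<le> b i"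
    and \<tau>: "\<And>i j. i \<le> j \<Longrightarrow> j < n \<Longrightarrow> \<tau> j \<le> \<tau> i" "\<And>i. i < n \<Longrightarrow> 0 \<le> \<tau> i"
    and D: "\<And>i j. 0 \<le> D i j" "\<And>i. i < n \<Longrightarrow> (\<Sum>j<n. D i j) \<le> 1" "\<And>j. j < n \<Longrightarrow> (\<Sum>i<n. D i j) \<le> 1"
  shows "(\<Sum>i<n. \<Sum>j<n. b i * \<tau> j * D i j) \<le> (\<Sum>i<n. b i * \<tau> i)"
proof -
  \<comment> \<open>Extension by zero keeps both sequences decreasing past \<open>n\<close>, because
    they are nonnegative, and kills the boundary term at \<open>n\<close>.\<close>
  define b' where "b' i = (if i < n then b i else 0)" for i
  define t' where "t' i = (if i < n then \<tau> i else 0)" for i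
  have b': "b' (Suc m) \<le> b' m" "0 \<le> b' m" and t': "t' (Suc m) \<le> t' m" "0 \<le> t' m" for m
    using b \<tau> by (auto simp: b'_def t'_def)
  \<comment> \<open>Dual potentials: \<open>b i * \<tau> j \<le> u i + v j\<close>, with equality for \<open>i = j\<close>.\<close>
  define u where "u i = (\<Sum>m=i..<n. (b' m - b' (Suc m)) * t' m)" for i
  define v where "v j = (\<Sum>m=j..<n. b' (Suc m) * (t' m - t' (Suc m)))" for j
  \<comment> \<open>Discrete product rule. Weighting the decrements of \<open>t'\<close> with
    \<open>b' (Suc m)\<close> instead of \<open>b' m\<close> makes the summands differences of
    \<open>b' m * t' m\<close>.\<close>
  have uv: "u i + v i = b i * \<tau> i" if "i < n" for i
  proof -
    have "u i + v i = (\<Sum>m=i..<n. b' m * t' m - b' (Suc m) * t' (Suc m))"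
      by (simp add: u_def v_def sum.distrib[symmetric] algebra_simps)
    also have "\<dots> = b' i * t' i - b' n * t' n"
      using sum_Suc_diff'[of i n "\<lambda>m. - (b' m * t' m)"] that by simp
    finally show ?thesis using that by (simp add: b'_def t'_def)
  qed
  have u0: "u i \<ge> 0" and v0: "v i \<ge> 0" for i
    unfolding u_def v_def using b' t' by (auto intro!: sum_nonneg mult_nonneg_nonneg)
  have le: "b i * \<tau> j \<le> u i + v j" if "i < n" "j < n" for i j
  \<comment> \<open>Passing from the diagonal entry \<open>(j, j)\<close> to row \<open>i\<close>
    changes the product by \<open>(b i - b j) * \<tau> j\<close>; the change of \<open>u\<close> is
    at least as large because \<open>t' m\<close> is at least \<open>\<tau> j\<close> for
    \<open>m < j\<close>. For \<open>j < i\<close> the potential \<open>v\<close> plays this part,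
    where \<open>b' (Suc m)\<close> is at least \<open>b i\<close> because
    \<open>Suc m \<le> i\<close>.\<close>
  proof (cases "i \<le> j")
    case True
    have "(b' i - b' j) * t' j = (\<Sum>m=i..<j. (b' m - b' (Suc m)) * t' j)"
      using sum_Suc_diff'[OF True, of "\<lambda>m. - b' m"] by (simp add: sum_distrib_right[symmetric])
    also have "\<dots> \<le> (\<Sum>m=i..<j. (b' m - b' (Suc m)) * t' m)"
      using b' \<tau>(1) that by (intro sum_mono mult_left_mono) (auto simp: t'_def)
    also have "\<dots> = u i - u j"
      unfolding u_def using sum.atLeastLessThan_concat[OF True, of n] that
      by (smt (verit) less_imp_le_nat)
    finally show ?thesis using uv[OF that(2)] that by (simp add: b'_def t'_def algebra_simps)
  next
    case False
    then have ji: "j \<le> i" by simp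
    have "b' i * (t' j - t' i) = (\<Sum>m=j..<i. b' i * (t' m - t' (Suc m)))"
      using sum_Suc_diff'[OF ji, of "\<lambda>m. - t' m"] by (simp add: sum_distrib_left[symmetric])
    also have "\<dots> \<le> (\<Sum>m=j..<i. b' (Suc m) * (t' m - t' (Suc m)))"
      using t' b(1) that by (intro sum_mono mult_right_mono) (auto simp: b'_def)
    also have "\<dots> = v j - v i"
      unfolding v_def using sum.atLeastLessThan_concat[OF ji, of n] that
      by (smt (verit) less_imp_le_nat)
    finally show ?thesis using uv[OF that(1)] that by (simp add: b'_def t'_def algebra_simps)
  qed
  have "(\<Sum>i<n. \<Sum>j<n. b i * \<tau> j * D i j) \<le> (\<Sum>i<n. \<Sum>j<n. (u i + v j) * D i j)"
    using D(1) le by (intro sum_mono mult_right_mono) auto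
  also have "\<dots> = (\<Sum>i<n. u i * (\<Sum>j<n. D i j)) + (\<Sum>i<n. \<Sum>j<n. v j * D i j)"
    by (simp add: distrib_right sum.distrib sum_distrib_left)
  also have "(\<Sum>i<n. \<Sum>j<n. v j * D i j) = (\<Sum>j<n. v j * (\<Sum>i<n. D i j))"
    by (subst sum.swap) (simp add: sum_distrib_left)
  also have "(\<Sum>i<n. u i * (\<Sum>j<n. D i j)) + (\<Sum>j<n. v j * (\<Sum>i<n. D i j))
      \<le> (\<Sum>i<n. u i * 1) + (\<Sum>j<n. v j * 1)"
    using u0 v0 D by (intro add_mono sum_mono mult_left_mono) auto
  also have "\<dots> = (\<Sum>i<n. b i * \<tau> i)"
    using uv by (simp add: sum.distrib[symmetric])
  finally show ?thesis .
qed

lemma sorted_enumeration: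
  fixes b :: "'n::finite \<Rightarrow> real"
  obtains g where "bij_betw g {..<CARD('n)} UNIV"
    "\<And>i j. i \<le> j \<Longrightarrow> j < CARD('n) \<Longrightarrow> b (g j) \<le> b (g i)"
proof -
  obtain ys where ys: "set ys = (UNIV :: 'n set)" "distinct ys"
    using finite_distinct_list[of "UNIV :: 'n set"] by auto
  define xs where "xs = sort_key (\<lambda>x. - b x) ys"
  have xs: "set xs = UNIV" "distinct xs" by (simp_all add: xs_def ys)
  have len: "length xs = CARD('n)" using xs distinct_card by metis
  show ?thesis
  proof (rule that[of "\<lambda>i. xs ! i"])
    show "bij_betw ((!) xs) {..<CARD('n)} UNIV"
      using bij_betw_nth[OF xs(2)] xs(1) len by simp
    have "sorted (map (\<lambda>x. - b x) xs)" by (simp add: xs_def)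
    then show "b (xs ! j) \<le> b (xs ! i)" if "i \<le> j" "j < CARD('n)" for i j
      using that sorted_nth_mono[of "map (\<lambda>x. - b x) xs" i j] len by simp
  qed
qed

section \<open>Low rank covariances\<close>

definition gp_cov :: "real^'q^'n \<Rightarrow> real \<Rightarrow> real^'n^'n" where
  "gp_cov X s = X ** transpose X + mat s"

lemma gp_cov_symmetric: "transpose (gp_cov X s) = gp_cov X s"
  by (simp add: gp_cov_def transpose_def vec_eq_iff matrix_matrix_mult_def mat_def mult.commute)

lemma gp_cov_mult: "gp_cov X s *v x = X *v (x v* X) + s *\<^sub>R x"
  by (simp add: gp_cov_def matrix_vector_mult_add_rdistrib mat_mult_vector
      matrix_vector_mul_assoc[symmetric])

lemma inner_matrix_mult: "x \<bullet> (A *v y) = (x v* A) \<bullet> (y :: real^'m)"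
  by (simp add: dot_lmul_matrix)

lemma gp_cov_quadratic: "x \<bullet> (gp_cov X s *v x) = (x v* X) \<bullet> (x v* X) + s * (x \<bullet> x)"
  by (simp add: gp_cov_mult inner_add_right inner_matrix_mult)

text \<open>\<open>f i v* X\<close> is \<open>X^T f_i\<close>, with squared norm
  \<open>k i - s\<close>; so the eigenvalue \<open>s\<close> belongs exactly to the eigenvectors
  orthogonal to the range of \<open>X\<close>.\<close>

lemma gp_cov_eigen:
  assumes "eigenbasis (gp_cov X s) f k"
  shows "X *v (f i v* X) = (k i - s) *\<^sub>R f i" "k i \<ge> s" "k i = s \<longleftrightarrow> f i v* X = 0"
proof -
  show "X *v (f i v* X) = (k i - s) *\<^sub>R f i"
    using eigenbasis_mult[OF assms, of i] by (simp add: gp_cov_mult algebra_simps)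
  have "(f i v* X) \<bullet> (f i v* X) = k i - s"
    using gp_cov_quadratic[of "f i" X s] eigenbasis_inner[OF assms, of i i]
    by (simp add: eigenbasis_mult[OF assms])
  then show "k i \<ge> s" "k i = s \<longleftrightarrow> f i v* X = 0"
    by (smt (verit) inner_ge_zero, smt (verit) inner_eq_zero_iff)
qed

lemma gp_cov_eigenbasis:
  fixes X :: "real^'q^'n"
  assumes "s > 0"
  obtains f k where "eigenbasis (gp_cov X s) f k" "\<And>i. k i \<ge> s" "\<And>i. k i > 0"
  using symmetric_eigenbasis[OF gp_cov_symmetric] gp_cov_eigen(2) assms by (metis less_le_trans)

text \<open>As a member of the range of \<open>X\<close>, such an eigenvector inherits
  \<open>S *v f i = k i *\<^sub>R f i\<close> from the equation \<open>S X = K X\<close>.\<close>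

lemma gp_cov_range:
  fixes X :: "real^'q^'n"
  assumes "eigenbasis (gp_cov X s) f k" "k i \<noteq> s"
  shows "f i = X *v ((1 / (k i - s)) *\<^sub>R (f i v* X))"
  using assms(2) by (simp add: matrix_vector_mult_scaleR gp_cov_eigen(1)[OF assms(1)])

lemma gp_cov_card_le:
  fixes X :: "real^'q^'n"
  assumes f: "eigenbasis (gp_cov X s) f k"
  shows "card {i. k i \<noteq> s} \<le> CARD('q)"
proof -
  let ?J = "{i. k i \<noteq> s}"
  have inj: "inj_on f ?J"
    by (rule inj_onI) (metis eigenbasis_inner[OF f] zero_neq_one)
  have "pairwise orthogonal (f ` ?J)"
    using eigenbasis_inner[OF f] by (auto simp: pairwise_def orthogonal_def)
  moreover have "0 \<notin> f ` ?J" using eigenbasis_inner[OF f] by (metis imageE inner_zero_left zero_neq_one)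
  ultimately have ind: "independent (f ` ?J)" by (rule pairwise_orthogonal_independent)
  have "f ` ?J \<subseteq> range ((*v) X)" using gp_cov_range[OF f] by blast
  then have "card (f ` ?J) \<le> dim (range ((*v) X))" using ind by (rule independent_card_le_dim)
  also have "\<dots> \<le> dim (UNIV :: (real^'q) set)" by (rule dim_image_le) simp
  finally show ?thesis using card_image[OF inj] by simp
qed

text \<open>Fewer than Q of the vectors \<open>X^T f_i\<close> are nonzero, so some latent direction
  is orthogonal to all of them. It is the free direction in which a rank deficient \<open>X\<close>
  can be extended.\<close>

lemma gp_cov_kernel:
  fixes X :: "real^'q^'n"
  assumes f: "eigenbasis (gp_cov X s) f k" and card: "card {i. k i \<noteq> s} < CARD('q)"
  obtains z where "norm z = 1" "X *v z = 0"
proof -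
  let ?J = "{i. k i \<noteq> s}"
  let ?B = "(\<lambda>i. f i v* X) ` ?J"
  have "dim ?B \<le> card ?B" by (rule dim_le_card') simp
  also have "\<dots> \<le> card ?J" by (rule card_image_le) simp
  finally have "dim ?B < DIM(real^'q)" using card by simp
  then obtain y where y: "y \<noteq> 0" "\<And>x. x \<in> span ?B \<Longrightarrow> orthogonal y x"
    using orthogonal_to_subspace_exists by metis
  have "f i \<bullet> (X *v y) = 0" for i
  proof (cases "k i = s")
    case True
    then show ?thesis using gp_cov_eigen(3)[OF f] by (simp add: inner_matrix_mult)
  next
    case False
    then have "orthogonal y (f i v* X)" using y(2) by (simp add: span_base)
    then show ?thesis by (simp add: inner_matrix_mult orthogonal_def inner_commute)
  qed
  then have "X *v y = 0" using eigenbasis_expand[OF f, of "X *v y"] by simp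
  with y(1) show ?thesis
    by (intro that[of "inverse (norm y) *\<^sub>R y"]) (simp_all add: matrix_vector_mult_scaleR)
qed

text \<open>Split \<open>x\<close> into its component in the range of \<open>X\<close>, where
  \<open>S\<close> acts like the covariance, and a component \<open>w\<close> killed by
  \<open>X^T\<close>, where only the bound by \<open>\<kappa>\<close> is known. The mixed terms
  vanish because \<open>S\<close> preserves the range. The resulting form is diagonal in the
  eigenbasis of the covariance.\<close>

lemma quadratic_upper:
  fixes X :: "real^'q^'n"
  assumes f: "eigenbasis (gp_cov X s) f k" and S: "transpose S = S" "S ** X = gp_cov X s ** X"
    and \<kappa>: "s \<le> \<kappa>" "\<And>j. k j \<noteq> s \<Longrightarrow> \<kappa> \<le> k j" "\<And>w. w v* X = 0 \<Longrightarrow> w \<bullet> (S *v w) \<le> \<kappa> * (w \<bullet> w)"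
  shows "x \<bullet> (S *v x) \<le> \<kappa> * (x \<bullet> x) + (\<Sum>j\<in>UNIV. max (k j - \<kappa>) 0 * (f j \<bullet> x)\<^sup>2)"
proof -
  let ?J = "{i. k i \<noteq> s}"
  have SX: "S *v (X *v z) = gp_cov X s *v (X *v z)" for z
    by (simp add: matrix_vector_mul_assoc S(2))
  have Sf: "S *v f j = k j *\<^sub>R f j" if "j \<in> ?J" for j
    using SX gp_cov_range[OF f, of j] eigenbasis_mult[OF f, of j] that by (metis (mono_tags) mem_Collect_eq)
  define v where "v = (\<Sum>j\<in>?J. (f j \<bullet> x) *\<^sub>R f j)"
  define w where "w = (\<Sum>j\<in>-?J. (f j \<bullet> x) *\<^sub>R f j)"
  have "(\<Sum>j\<in>UNIV. (f j \<bullet> x) *\<^sub>R f j) = v + w"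
    unfolding v_def w_def by (subst sum.union_disjoint[symmetric]) auto
  then have xvw: "x = v + w" using eigenbasis_expand[OF f, of x] by simp
  have fw: "f j \<bullet> w = (if j \<in> ?J then 0 else f j \<bullet> x)" for j
    by (auto simp: w_def inner_sum_right eigenbasis_inner[OF f] if_distrib sum.delta cong: if_cong)
  have fv: "f j \<bullet> v = (if j \<in> ?J then f j \<bullet> x else 0)" for j
    by (auto simp: v_def inner_sum_right eigenbasis_inner[OF f] if_distrib sum.delta cong: if_cong)
  have "w v* X = 0"
    unfolding w_def
    by (simp add: linear_sum[OF matrix_vector_mul_linear, of "transpose X", simplified]
        linear_cmul[OF matrix_vector_mul_linear, of "transpose X", simplified])
       (rule sum.neutral, use gp_cov_eigen(3)[OF f] in auto)
  then have w: "w \<bullet> (S *v w) \<le> \<kappa> * (w \<bullet> w)" by (rule \<kappa>(3))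
  have Sv: "S *v v = (\<Sum>j\<in>?J. (k j * (f j \<bullet> x)) *\<^sub>R f j)"
    unfolding v_def by (simp add: linear_sum[OF matrix_vector_mul_linear] matrix_vector_mult_scaleR Sf mult.commute)
  have "w \<bullet> (S *v v) = 0"
    unfolding Sv by (simp add: inner_sum_right inner_commute[of w] fw)
  moreover have "v \<bullet> (S *v w) = w \<bullet> (S *v v)" using symmetric_dot[OF S(1), of v w] by (simp add: inner_commute)
  moreover have "v \<bullet> (S *v v) = (\<Sum>j\<in>?J. k j * (f j \<bullet> x)\<^sup>2)"
    unfolding Sv by (simp add: inner_sum_right inner_commute[of v] fv power2_eq_square mult_ac)
  ultimately have "x \<bullet> (S *v x) = (\<Sum>j\<in>?J. k j * (f j \<bullet> x)\<^sup>2) + w \<bullet> (S *v w)"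
    unfolding xvw[symmetric]
    by (subst (1 2) xvw) (simp add: matrix_vector_right_distrib inner_add_left inner_add_right)
  also have "\<dots> \<le> (\<Sum>j\<in>?J. k j * (f j \<bullet> x)\<^sup>2) + \<kappa> * (w \<bullet> w)" using w by simp
  also have "w \<bullet> w = (\<Sum>j\<in>-?J. (f j \<bullet> x)\<^sup>2)"
    unfolding eigenbasis_parseval[OF f, of w] fw
    by (rule sum.mono_neutral_cong_right) (auto simp: power2_eq_square)
  also have "(\<Sum>j\<in>?J. k j * (f j \<bullet> x)\<^sup>2) + \<kappa> * (\<Sum>j\<in>-?J. (f j \<bullet> x)\<^sup>2)
      = (\<Sum>j\<in>UNIV. (if k j \<noteq> s then k j else \<kappa>) * (f j \<bullet> x)\<^sup>2)"
    by (simp only: if_distribR if_distrib[where f="\<lambda>c. c * _"] sum_distrib_left, subst sum.If_cases) auto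
  also have "\<dots> \<le> (\<Sum>j\<in>UNIV. (\<kappa> + max (k j - \<kappa>) 0) * (f j \<bullet> x)\<^sup>2)"
    by (intro sum_mono mult_right_mono) auto
  also have "\<dots> = (\<Sum>j\<in>UNIV. \<kappa> * (f j \<bullet> x)\<^sup>2 + max (k j - \<kappa>) 0 * (f j \<bullet> x)\<^sup>2)"
    by (simp add: distrib_right)
  also have "\<dots> = \<kappa> * (x \<bullet> x) + (\<Sum>j\<in>UNIV. max (k j - \<kappa>) 0 * (f j \<bullet> x)\<^sup>2)"
    by (simp add: eigenbasis_parseval[OF f, of x x] sum.distrib sum_distrib_left power2_eq_square)
  finally show ?thesis .
qed

text \<open>The values above \<open>c\<close> occupy an initial segment of a decreasing enumeration.
  Through this, rank bounds become statements about single positions.\<close>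

lemma sorted_enumeration_threshold:
  fixes k :: "'n::finite \<Rightarrow> 'a::linorder"
  assumes g: "bij_betw g {..<CARD('n)} UNIV" "\<And>i j. i \<le> j \<Longrightarrow> j < CARD('n) \<Longrightarrow> k (g j) \<le> k (g i)"
    and i: "i < CARD('n)"
  shows "k (g i) \<le> c \<Longrightarrow> card {j. c < k j} \<le> i" "c < k (g i) \<Longrightarrow> i < card {j. c < k j}"
proof -
  have gj: "\<exists>m<CARD('n). j = g m" for j using g(1) by (auto simp: bij_betw_def image_iff)
  show "card {j. c < k j} \<le> i" if "k (g i) \<le> c"
  proof -
    have "{j. c < k j} \<subseteq> g ` {..<i}"
    proof
      fix j assume "j \<in> {j. c < k j}"
      then obtain m where "m < CARD('n)" "j = g m" "c < k (g m)" using gj[of j] by auto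
      then show "j \<in> g ` {..<i}" using g(2)[of i m] that by force
    qed
    from card_mono[OF _ this] show ?thesis using card_image_le[of "{..<i}" g] by simp
  qed
  show "i < card {j. c < k j}" if "c < k (g i)"
  proof -
    have "g ` {..i} \<subseteq> {j. c < k j}" using g(2) i that by (auto intro: less_le_trans)
    from card_mono[OF _ this] have "card (g ` {..i}) \<le> card {j. c < k j}" by simp
    moreover have "card (g ` {..i}) = Suc i"
      by (subst card_image) (use g(1) i in \<open>auto simp: bij_betw_def inj_on_def\<close>)
    ultimately show ?thesis by simp
  qed
qed

theorem gp_cost_lower_bound:
  fixes X X' :: "real^'q^'n"
  assumes f: "eigenbasis (gp_cov X s) f k" and s: "s > 0" "s' > 0"
    and S: "transpose S = S" "S ** X = gp_cov X s ** X" "trace S = trace (gp_cov X s)"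
    and \<kappa>: "s \<le> \<kappa>" "\<And>j. k j \<noteq> s \<Longrightarrow> \<kappa> \<le> k j" "\<And>w. w v* X = 0 \<Longrightarrow> w \<bullet> (S *v w) \<le> \<kappa> * (w \<bullet> w)"
      "card {i. k i \<noteq> s} < CARD('q) \<Longrightarrow> \<kappa> = s"
  shows "ln (det (gp_cov X s)) + real CARD('n)
      \<le> ln (det (gp_cov X' s')) + trace (matrix_inv (gp_cov X' s') ** S)"
proof -
  obtain e l where e: "eigenbasis (gp_cov X' s') e l" "\<And>i. l i \<ge> s'" "\<And>i. l i > 0"
    using gp_cov_eigenbasis[OF s(2)] by metis
  have ks: "k j \<ge> s" "k j > 0" for j using gp_cov_eigen(2)[OF f, of j] s by auto
  \<comment> \<open>These are the eigenvalues of \<open>I / s' - K'^-1\<close> for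
    \<open>K' = gp_cov X' s'\<close>; they are nonnegative, and at most Q of them are
    positive.\<close>
  define b where "b i = 1 / s' - 1 / l i" for i
  define \<tau> where "\<tau> j = max (k j - \<kappa>) 0" for j
  have b0: "b i \<ge> 0" for i using e(2)[of i] s by (simp add: b_def frac_le)
  have bl: "0 < b i \<longleftrightarrow> l i \<noteq> s'" for i
    using e(2)[of i] e(3)[of i] s by (auto simp: b_def field_simps)
  obtain g where g: "bij_betw g {..<CARD('n)} UNIV"
    "\<And>i j. i \<le> j \<Longrightarrow> j < CARD('n) \<Longrightarrow> b (g j) \<le> b (g i)" using sorted_enumeration by blast
  obtain h where h: "bij_betw h {..<CARD('n)} UNIV"
    "\<And>i j. i \<le> j \<Longrightarrow> j < CARD('n) \<Longrightarrow> k (h j) \<le> k (h i)" using sorted_enumeration by blast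
  note D = eigenbasis_overlap[OF e(1) f]
  have re: "(\<Sum>m<CARD('n). F (g m)) = (\<Sum>i\<in>UNIV. F i)"
    and rh: "(\<Sum>m<CARD('n). F (h m)) = (\<Sum>i\<in>UNIV. F i)" for F :: "'n \<Rightarrow> real"
    using sum.reindex_bij_betw[OF g(1)] sum.reindex_bij_betw[OF h(1)] by blast+
  \<comment> \<open>The truncation at \<open>\<kappa>\<close> costs nothing: either the factor
    \<open>b (g m)\<close> is zero, or \<open>m\<close> is less than Q and then
    \<open>k (h m)\<close> is at least \<open>\<kappa>\<close>, being a retained eigenvalue when
    \<open>X\<close> has full rank and because \<open>\<kappa> = s\<close> otherwise.\<close>
  have b\<tau>: "b (g m) * (\<kappa> + \<tau> (h m)) = b (g m) * k (h m)" if m: "m < CARD('n)" for m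
  proof (cases "b (g m) > 0")
    case True
    have "m < card {i. 0 < b i}" by (rule sorted_enumeration_threshold(2)[where k=b, OF g m True])
    also have "\<dots> \<le> CARD('q)" using gp_cov_card_le[OF e(1)] by (simp add: bl)
    finally have mq: "m < CARD('q)" .
    have "k (h m) \<ge> \<kappa>"
    proof (cases "card {i. k i \<noteq> s} < CARD('q)")
      case True
      then show ?thesis using \<kappa>(4) ks by simp
    next
      case False
      have "{i. k i \<noteq> s} = {i. s < k i}" using ks by (auto simp: less_le)
      then have "\<not> card {i. s < k i} \<le> m" using False mq by simp
      then have "\<not> k (h m) \<le> s" using sorted_enumeration_threshold(1)[where k=k, OF h m] by blast
      then show ?thesis using \<kappa>(2) by auto
    qed
    then show ?thesis by (simp add: \<tau>_def)
  next
    case False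
    then have "b (g m) = 0" using b0[of "g m"] by linarith
    then show ?thesis by simp
  qed
  have "(\<Sum>i\<in>UNIV. b i * (e i \<bullet> (S *v e i)))
      \<le> (\<Sum>i\<in>UNIV. b i * (\<kappa> + (\<Sum>j\<in>UNIV. \<tau> j * (f j \<bullet> e i)\<^sup>2)))"
    using quadratic_upper[OF f S(1,2) \<kappa>(1-3)] b0
    by (intro sum_mono mult_left_mono) (auto simp: \<tau>_def dest!: meta_spec[of _ "e _"]
        simp: eigenbasis_inner[OF e(1)] intro: order_trans)
  also have "\<dots> = \<kappa> * (\<Sum>i\<in>UNIV. b i) + (\<Sum>i\<in>UNIV. \<Sum>j\<in>UNIV. b i * \<tau> j * (f j \<bullet> e i)\<^sup>2)"
    by (simp add: distrib_left sum.distrib sum_distrib_left mult_ac)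
  also have "(\<Sum>i\<in>UNIV. \<Sum>j\<in>UNIV. b i * \<tau> j * (f j \<bullet> e i)\<^sup>2)
      = (\<Sum>i<CARD('n). \<Sum>j<CARD('n). b (g i) * \<tau> (h j) * (f (h j) \<bullet> e (g i))\<^sup>2)"
    by (rule trans[OF sum.cong[OF refl rh[symmetric]] re[symmetric]])
  also have "\<dots> \<le> (\<Sum>i<CARD('n). b (g i) * \<tau> (h i))"
  proof (rule substochastic_rearrangement)
    show "\<tau> (h j) \<le> \<tau> (h i)" if "i \<le> j" "j < CARD('n)" for i j
      unfolding \<tau>_def using h(2)[OF that] by (intro max.mono) auto
    show "(\<Sum>j<CARD('n). (f (h j) \<bullet> e (g i))\<^sup>2) \<le> 1" for i
      using rh[of "\<lambda>j. (f j \<bullet> e (g i))\<^sup>2"] D by simp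
    show "(\<Sum>i<CARD('n). (f (h j) \<bullet> e (g i))\<^sup>2) \<le> 1" for j
      using re[of "\<lambda>i. (f (h j) \<bullet> e i)\<^sup>2"] D by simp
  qed (use g(2) b0 in \<open>auto simp: \<tau>_def\<close>)
  also have "\<kappa> * (\<Sum>i\<in>UNIV. b i) + \<dots> = (\<Sum>i<CARD('n). b (g i) * (\<kappa> + \<tau> (h i)))"
    by (simp add: re[symmetric] distrib_left sum.distrib sum_distrib_left mult.commute)
  also have "\<dots> = (\<Sum>i<CARD('n). b (g i) * k (h i))" using b\<tau> by (intro sum.cong) auto
  finally have bS: "(\<Sum>i\<in>UNIV. b i * (e i \<bullet> (S *v e i))) \<le> (\<Sum>i<CARD('n). b (g i) * k (h i))" by simp
  have "(\<Sum>i\<in>UNIV. e i \<bullet> (S *v e i)) = (\<Sum>i\<in>UNIV. k i)"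
    using eigenbasis_trace[OF e(1), of S] eigenbasis_trace[OF f, of "gp_cov X s"] S(3)
    by (simp add: eigenbasis_mult[OF f] eigenbasis_inner[OF f])
  then have trS: "(\<Sum>i\<in>UNIV. e i \<bullet> (S *v e i)) = (\<Sum>m<CARD('n). k (h m))" by (simp add: rh)
  \<comment> \<open>Both spectra are now paired in decreasing order, since \<open>l\<close>
    decreases along \<open>g\<close> together with \<open>b\<close>, and the scalar inequality
    applies to each pair.\<close>
  have "ln (det (gp_cov X s)) + real CARD('n) = (\<Sum>m<CARD('n). ln (k (h m)) + 1)"
    using eigenbasis_ln_det(2)[OF f ks(2)] rh[of "\<lambda>i. ln (k i)"] by (simp add: sum.distrib)
  also have "\<dots> \<le> (\<Sum>m<CARD('n). ln (l (g m)) + k (h m) / l (g m))"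
    using e(3) ks(2) by (intro sum_mono ln_add_div_ge)
  also have "\<dots> = (\<Sum>m<CARD('n). ln (l (g m)) + (k (h m) / s' - b (g m) * k (h m)))"
    by (simp add: b_def algebra_simps)
  also have "\<dots> = (\<Sum>i\<in>UNIV. ln (l i)) + ((\<Sum>m<CARD('n). k (h m)) / s' - (\<Sum>m<CARD('n). b (g m) * k (h m)))"
    using re[of "\<lambda>i. ln (l i)"] by (simp add: sum.distrib sum_subtractf sum_divide_distrib)
  also have "\<dots> \<le> (\<Sum>i\<in>UNIV. ln (l i)) + ((\<Sum>i\<in>UNIV. e i \<bullet> (S *v e i)) / s'
      - (\<Sum>i\<in>UNIV. b i * (e i \<bullet> (S *v e i))))"
    using bS trS by simp
  also have "\<dots> = (\<Sum>i\<in>UNIV. ln (l i)) + (\<Sum>i\<in>UNIV. (e i \<bullet> (S *v e i)) / l i)"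
    by (simp add: sum_divide_distrib sum_subtractf[symmetric] b_def algebra_simps)
  also have "\<dots> = ln (det (gp_cov X' s')) + trace (matrix_inv (gp_cov X' s') ** S)"
    using eigenbasis_ln_det(2)[OF e(1,3)] eigenbasis_trace_inv_mult[OF e(1,3)] by simp
  finally show ?thesis .
qed

section \<open>The derivative of the log marginal likelihood\<close>

lemma trace_scaleR: "trace (c *\<^sub>R A) = c * trace (A :: real^'n^'n)"
  by (simp add: trace_def sum_distrib_left)

lemma bounded_bilinear_matrix_mult:
  "bounded_bilinear ((**) :: real^'m^'n \<Rightarrow> real^'k^'m \<Rightarrow> real^'k^'n)"
  unfolding bilinear_conv_bounded_bilinear[symmetric] bilinear_def
  by (auto intro!: linearI simp: vec_eq_iff matrix_matrix_mult_def sum.distrib sum_distrib_left algebra_simps)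

lemmas matrix_mult_linear_simps =
  bounded_bilinear.add_left[OF bounded_bilinear_matrix_mult]
  bounded_bilinear.add_right[OF bounded_bilinear_matrix_mult]
  bounded_bilinear.diff_left[OF bounded_bilinear_matrix_mult]
  bounded_bilinear.diff_right[OF bounded_bilinear_matrix_mult]
  bounded_bilinear.scaleR_left[OF bounded_bilinear_matrix_mult]
  bounded_bilinear.scaleR_right[OF bounded_bilinear_matrix_mult]

lemma mat_eq_scaleR: "mat t = t *\<^sub>R (mat 1 :: real^'n^'n)"
  by (simp add: vec_eq_iff mat_def)

text \<open>Cyclicity of the trace; this is how the likelihood comes to depend on the data only
  through \<open>sample_cov Y\<close>.\<close>

lemma sum_column_quadratic:
  fixes Y :: "real^'m^'n" and A :: "real^'n^'n"
  shows "(\<Sum>j\<in>UNIV. column j Y \<bullet> (A *v column j Y)) = real CARD('m) * trace (A ** sample_cov Y)"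
proof -
  have "(\<Sum>j\<in>UNIV. column j Y \<bullet> (A *v column j Y)) = trace (transpose Y ** (A ** Y))"
    by (simp add: trace_def matrix_matrix_mult_def matrix_vector_mult_def transpose_def inner_vec_def
        column_def)
  also have "\<dots> = trace (A ** (Y ** transpose Y))"
    by (metis matrix_mul_assoc trace_mul_sym)
  also have "Y ** transpose Y = real CARD('m) *\<^sub>R sample_cov Y"
    by (simp add: sample_cov_def)
  also have "A ** (real CARD('m) *\<^sub>R sample_cov Y) = real CARD('m) *\<^sub>R (A ** sample_cov Y)"
    by (simp add: matrix_mult_linear_simps)
  finally show ?thesis by (simp add: trace_scaleR)
qed

lemma sample_cov_symmetric: "transpose (sample_cov Y) = sample_cov Y"
  by (simp add: sample_cov_def transpose_def vec_eq_iff matrix_matrix_mult_def mult.commute)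

lemma ln_gaussian_density:
  fixes K :: "real^'n^'n"
  assumes "det K > 0"
  shows "ln (gaussian_density 0 K y)
    = - (y \<bullet> (matrix_inv K *v y)) / 2 - (real CARD('n) * ln (2 * pi) + ln (det K)) / 2"
  using assms by (simp add: gaussian_density_def ln_div ln_sqrt ln_mult ln_realpow distrib_left)

definition gp_cost :: "real^'n^'n \<Rightarrow> real^'q^'n \<Rightarrow> real \<Rightarrow> real" where
  "gp_cost S X s = ln (det (gp_cov X s)) + trace (matrix_inv (gp_cov X s) ** S)"

lemma gp_cov_det_pos: "s > 0 \<Longrightarrow> det (gp_cov X s) > 0"
  using gp_cov_eigenbasis eigenbasis_ln_det(1) by metis

lemma log_marginal_eq_cost:
  fixes Y :: "real^'m^'n"
  assumes "s > 0"
  shows "log_marginal Y X s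
    = - (real CARD('m) / 2) * (real CARD('n) * ln (2 * pi) + gp_cost (sample_cov Y) X s)"
proof -
  have "log_marginal Y X s = (\<Sum>j\<in>UNIV. - (column j Y \<bullet> (matrix_inv (gp_cov X s) *v column j Y)) / 2
      - (real CARD('n) * ln (2 * pi) + ln (det (gp_cov X s))) / 2)"
    unfolding log_marginal_def gp_cov_def[symmetric]
    by (simp add: ln_gaussian_density[OF gp_cov_det_pos[OF assms]])
  also have "\<dots> = - ((\<Sum>j\<in>UNIV. column j Y \<bullet> (matrix_inv (gp_cov X s) *v column j Y))
      + real CARD('m) * (real CARD('n) * ln (2 * pi) + ln (det (gp_cov X s)))) / 2"
    by (simp add: sum_subtractf sum_negf sum_divide_distrib[symmetric] field_simps)
  finally show ?thesis by (simp add: sum_column_quadratic gp_cost_def field_simps)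
qed

lemma log_marginal_le_iff:
  fixes Y :: "real^'m^'n"
  assumes "s > 0" "s' > 0"
  shows "log_marginal Y X' s' \<le> log_marginal Y X s
    \<longleftrightarrow> gp_cost (sample_cov Y) X s \<le> gp_cost (sample_cov Y) X' s'"
  using assms by (simp add: log_marginal_eq_cost)

section \<open>Differentiability of determinants and inverses\<close>

lemma differentiable_prod:
  fixes f :: "'i \<Rightarrow> 'a::real_normed_vector \<Rightarrow> real"
  assumes "finite I" "\<And>i. i \<in> I \<Longrightarrow> f i differentiable (at x)"
  shows "(\<lambda>x. \<Prod>i\<in>I. f i x) differentiable (at x)"
  using assms by (induction I rule: finite_induct) (auto intro: differentiable_mult)

lemma differentiable_det:
  fixes A :: "'a::real_normed_vector \<Rightarrow> real^'n^'n"
  assumes "\<And>i j. (\<lambda>x. A x $ i $ j) differentiable (at x)"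
  shows "(\<lambda>x. det (A x)) differentiable (at x)"
  unfolding det_def using assms by (auto intro!: differentiable_sum differentiable_mult differentiable_prod)

text \<open>Cramer's rule writes the component as a quotient of determinants near \<open>x\<close>.
  Only differentiability is extracted here; the value of the derivative is found later by a touching
  argument.\<close>

lemma differentiable_inv_component:
  fixes A :: "'a::real_normed_vector \<Rightarrow> real^'n^'n"
  assumes A: "\<And>i j. (\<lambda>x. A x $ i $ j) differentiable (at x)"
    and U: "open U" "x \<in> U" "\<And>x. x \<in> U \<Longrightarrow> det (A x) \<noteq> 0"
  shows "(\<lambda>x. (matrix_inv (A x) *v y) $ k) differentiable (at x)"
proof -
  let ?C = "\<lambda>x. (\<chi> i j. if j = k then y $ i else A x $ i $ j)"
  have eq: "(matrix_inv (A x) *v y) $ k = det (?C x) / det (A x)" if "x \<in> U" for x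
    using cramer[OF U(3)[OF that], of "matrix_inv (A x) *v y" y] matrix_inv_mult(1)[OF U(3)[OF that]]
    by (simp add: matrix_vector_mul_assoc vec_eq_iff)
  have "(\<lambda>x. ?C x $ i $ j) differentiable (at x)" for i j
    using A by (cases "j = k") auto
  then have "(\<lambda>x. det (?C x)) differentiable (at x)" by (rule differentiable_det)
  then have "(\<lambda>x. det (?C x) / det (A x)) differentiable (at x)"
    using differentiable_det[OF A] U by (intro differentiable_divide) auto
  then obtain D where "((\<lambda>x. det (?C x) / det (A x)) has_derivative D) (at x)"
    by (auto simp: differentiable_def)
  then have "((\<lambda>x. (matrix_inv (A x) *v y) $ k) has_derivative D) (at x)"
    by (rule has_derivative_transform_within_open[OF _ U(1,2)]) (simp add: eq)
  then show ?thesis by (auto simp: differentiable_def)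
qed

lemma bounded_linear_transpose: "bounded_linear (transpose :: real^'m^'n \<Rightarrow> real^'n^'m)"
  unfolding linear_conv_bounded_linear[symmetric]
  by (rule linearI) (simp_all add: transpose_def vec_eq_iff)

lemma bounded_linear_mat: "bounded_linear (mat :: real \<Rightarrow> real^'n^'n)"
  unfolding linear_conv_bounded_linear[symmetric]
  by (rule linearI) (simp_all add: mat_def vec_eq_iff)

definition gp_cov_deriv :: "real^'q^'n \<Rightarrow> (real^'q^'n) \<times> real \<Rightarrow> real^'n^'n" where
  "gp_cov_deriv X h = X ** transpose (fst h) + fst h ** transpose X + mat (snd h)"

lemma has_derivative_gp_cov:
  fixes X :: "real^'q^'n"
  shows "((\<lambda>p. gp_cov (fst p) (snd p)) has_derivative gp_cov_deriv X) (at (X, s))"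
proof -
  have 1: "((\<lambda>p::(real^'q^'n) \<times> real. transpose (fst p)) has_derivative (\<lambda>h. transpose (fst h))) (at (X, s))"
    by (intro bounded_linear.has_derivative[OF bounded_linear_transpose] derivative_intros)
  have 2: "((\<lambda>p::(real^'q^'n) \<times> real. mat (snd p) :: real^'n^'n) has_derivative (\<lambda>h. mat (snd h))) (at (X, s))"
    by (intro bounded_linear.has_derivative[OF bounded_linear_mat] derivative_intros)
  have 3: "((\<lambda>p::(real^'q^'n) \<times> real. fst p) has_derivative fst) (at (X, s))"
    by (intro derivative_intros)
  from has_derivative_add[OF bounded_bilinear.FDERIV[OF bounded_bilinear_matrix_mult 3 1] 2]
  show ?thesis by (simp add: gp_cov_def[abs_def] gp_cov_deriv_def[abs_def])
qed

lemma has_derivative_linear_gp_cov: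
  fixes X :: "real^'q^'n" and F :: "real^'n^'n \<Rightarrow> real"
  assumes "linear F"
  shows "((\<lambda>p. F (gp_cov (fst p) (snd p))) has_derivative (\<lambda>h. F (gp_cov_deriv X h))) (at (X, s))"
  using assms has_derivative_gp_cov
  by (intro bounded_linear.has_derivative[of F]) (simp_all add: linear_conv_bounded_linear)

lemma differentiable_gp_cov:
  fixes X :: "real^'q^'n"
  shows "(\<lambda>p. gp_cov (fst p) (snd p) $ i $ j) differentiable (at (X, s))"
proof -
  have "linear (\<lambda>A::real^'n^'n. A $ i $ j)" by (rule linearI) simp_all
  from has_derivative_linear_gp_cov[OF this] show ?thesis by (auto simp: differentiable_def)
qed

lemma open_snd_pos: "open {p :: 'a::topological_space \<times> real. snd p > 0}"
  by (intro open_Collect_less continuous_intros)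

lemma trace_inv_self:
  fixes K :: "real^'n^'n"
  shows "det K \<noteq> 0 \<Longrightarrow> trace (matrix_inv K ** K) = real CARD('n)"
  by (simp add: matrix_inv_mult trace_I)

text \<open>The tangent inequality of the concave function \<open>ln \<circ> det\<close> determines its derivative: a
  differentiable function that touches another one from below has the same derivative.\<close>

lemma has_derivative_ln_det_gp_cov:
  fixes X :: "real^'q^'n"
  assumes s: "s > 0"
  shows "((\<lambda>p. ln (det (gp_cov (fst p) (snd p)))) has_derivative
    (\<lambda>h. trace (matrix_inv (gp_cov X s) ** gp_cov_deriv X h))) (at (X, s))"
proof -
  let ?P = "matrix_inv (gp_cov X s)"
  let ?f = "\<lambda>p::(real^'q^'n) \<times> real. ln (det (gp_cov (fst p) (snd p)))"
  have "linear (\<lambda>A. trace (?P ** A))"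
    by (rule linearI) (simp_all add: trace_def matrix_matrix_mult_def sum.distrib sum_distrib_left algebra_simps)
  note T = has_derivative_linear_gp_cov[OF this, of X s]
  obtain D0 where "((\<lambda>p. det (gp_cov (fst p) (snd p))) has_derivative D0) (at (X, s))"
    using differentiable_det[OF differentiable_gp_cov] by (auto simp: differentiable_def)
  from has_derivative_ln[OF _ this] gp_cov_det_pos[OF s]
  obtain D where D: "(?f has_derivative D) (at (X, s))" by auto
  have "(\<lambda>h. D h - trace (?P ** gp_cov_deriv X h)) = (\<lambda>h. 0)"
  proof (rule differential_zero_maxmin[OF _ open_snd_pos has_derivative_diff[OF D T]])
    have "?f p - trace (?P ** gp_cov (fst p) (snd p)) \<le> ?f (X, s) - trace (?P ** gp_cov X s)"
      if p: "snd p > 0" for p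
    proof -
      obtain e k f l where "eigenbasis (gp_cov (fst p) (snd p)) e k" "\<And>i. k i > 0"
        "eigenbasis (gp_cov X s) f l" "\<And>i. l i > 0"
        using gp_cov_eigenbasis[OF p] gp_cov_eigenbasis[OF s] by metis
      from ln_det_tangent[OF this] show ?thesis
        using trace_inv_self[of "gp_cov X s"] gp_cov_det_pos[OF s, of X] by simp
    qed
    then show "(\<forall>y\<in>{p. 0 < snd p}. ?f y - trace (?P ** gp_cov (fst y) (snd y))
          \<le> ?f (X, s) - trace (?P ** gp_cov (fst (X, s)) (snd (X, s))))
      \<or> (\<forall>y\<in>{p. 0 < snd p}. ?f (X, s) - trace (?P ** gp_cov (fst (X, s)) (snd (X, s)))
          \<le> ?f y - trace (?P ** gp_cov (fst y) (snd y)))" by simp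
  qed (use s in simp)
  then have "D = (\<lambda>h. trace (?P ** gp_cov_deriv X h))" by (simp add: fun_eq_iff)
  with D show ?thesis by simp
qed

text \<open>Completing the square gives
  \<open>y \<bullet> K^-1 y + z \<bullet> K z \<ge> 2 (z \<bullet> y)\<close>, with equality at
  \<open>z = K^-1 y\<close>. With \<open>z\<close> frozen at its value for \<open>(X, s)\<close> the
  left side is minimal there, so the derivative of its first term is minus that of the second, which
  is linear in \<open>K\<close>.\<close>

lemma has_derivative_inv_quadratic_gp_cov:
  fixes X :: "real^'q^'n"
  assumes s: "s > 0"
  shows "((\<lambda>p. y \<bullet> (matrix_inv (gp_cov (fst p) (snd p)) *v y)) has_derivative
    (\<lambda>h. - (y \<bullet> ((matrix_inv (gp_cov X s) ** gp_cov_deriv X h ** matrix_inv (gp_cov X s)) *v y)))) (at (X, s))"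
proof -
  let ?P = "matrix_inv (gp_cov X s)"
  let ?f = "\<lambda>p::(real^'q^'n) \<times> real. y \<bullet> (matrix_inv (gp_cov (fst p) (snd p)) *v y)"
  define z where "z = ?P *v y"
  have d: "det (gp_cov (fst p) (snd p)) \<noteq> 0" if "snd p > 0" for p :: "(real^'q^'n) \<times> real"
    using gp_cov_det_pos[OF that, of "fst p"] by simp
  have "linear (\<lambda>A. z \<bullet> (A *v z))"
    by (rule linearI) (simp_all add: matrix_vector_mult_add_rdistrib inner_add_right
        scaleR_matrix_vector_assoc[symmetric])
  note T = has_derivative_linear_gp_cov[OF this, of X s]
  have "?f differentiable (at (X, s))"
    unfolding inner_vec_def inner_real_def
    by (intro differentiable_sum differentiable_mult differentiable_const ballI
        differentiable_inv_component[OF differentiable_gp_cov open_snd_pos]) (use s d in auto)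
  then obtain D where D: "(?f has_derivative D) (at (X, s))" by (auto simp: differentiable_def)
  have sym: "(matrix_inv (gp_cov (fst p) (snd p)) *v y) \<bullet> x = y \<bullet> (matrix_inv (gp_cov (fst p) (snd p)) *v x)"
    if "snd p > 0" for p :: "(real^'q^'n) \<times> real" and x
    by (rule symmetric_dot[OF matrix_inv_symmetric[OF d[OF that] gp_cov_symmetric]])
  have Pz: "z \<bullet> (B *v z) = y \<bullet> ((?P ** B ** ?P) *v y)" for B
    using sym[of "(X, s)"] s by (simp add: z_def matrix_vector_mul_assoc matrix_mul_assoc)
  have "(\<lambda>h. D h + z \<bullet> (gp_cov_deriv X h *v z)) = (\<lambda>h. 0)"
  proof (rule differential_zero_maxmin[OF _ open_snd_pos has_derivative_add[OF D T]])
    have Kz: "gp_cov X s *v z = y"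
      using matrix_inv_mult(1)[OF d[of "(X, s)"]] s by (simp add: z_def matrix_vector_mul_assoc)
    have "?f (X, s) + z \<bullet> (gp_cov X s *v z) \<le> ?f p + z \<bullet> (gp_cov (fst p) (snd p) *v z)"
      if p: "snd p > 0" for p
    proof -
      let ?K = "gp_cov (fst p) (snd p)"
      define x where "x = matrix_inv ?K *v y"
      have Kx: "?K *v x = y" using matrix_inv_mult(1)[OF d[OF p]] by (simp add: x_def matrix_vector_mul_assoc)
      have "0 \<le> (z - x) \<bullet> (?K *v (z - x))" unfolding gp_cov_quadratic using p by simp
      also have "\<dots> = z \<bullet> (?K *v z) - 2 * (z \<bullet> y) + x \<bullet> y"
        using symmetric_dot[OF gp_cov_symmetric, of "fst p" "snd p" x z]
        by (simp add: matrix_vector_mult_diff_distrib inner_diff_left inner_diff_right Kx inner_commute)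
      finally show ?thesis by (simp add: Kz x_def[symmetric] z_def[symmetric] inner_commute)
    qed
    then show "(\<forall>q\<in>{p. 0 < snd p}. ?f q + z \<bullet> (gp_cov (fst q) (snd q) *v z)
          \<le> ?f (X, s) + z \<bullet> (gp_cov (fst (X, s)) (snd (X, s)) *v z))
      \<or> (\<forall>q\<in>{p. 0 < snd p}. ?f (X, s) + z \<bullet> (gp_cov (fst (X, s)) (snd (X, s)) *v z)
          \<le> ?f q + z \<bullet> (gp_cov (fst q) (snd q) *v z))" by simp
  qed (use s in simp)
  then have "D = (\<lambda>h. - (z \<bullet> (gp_cov_deriv X h *v z)))" by (simp add: fun_eq_iff eq_neg_iff_add_eq_0)
  with D show ?thesis by (simp add: Pz)
qed

definition gp_gradient :: "real^'n^'n \<Rightarrow> real^'q^'n \<Rightarrow> real \<Rightarrow> real^'n^'n" where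
  "gp_gradient S X s = matrix_inv (gp_cov X s) ** (gp_cov X s - S) ** matrix_inv (gp_cov X s)"

text \<open>The two mixed terms in the derivative of \<open>X X^T\<close> contribute equally because
  \<open>W\<close> is symmetric. This exhibits \<open>2 W X\<close> and \<open>trace W\<close> as
  the partial gradients, up to a common factor.\<close>

lemma trace_mult_gp_cov_deriv:
  fixes X H :: "real^'q^'n"
  assumes "transpose W = W"
  shows "trace (gp_cov_deriv X (H, t) ** W) = 2 * (H \<bullet> (W ** X)) + t * trace W"
proof -
  have 1: "trace (transpose H ** B) = H \<bullet> B" for B :: "real^'q^'n"
    by (simp add: trace_def matrix_matrix_mult_def transpose_def inner_vec_def) (rule sum.swap)
  have "trace (X ** transpose H ** W) = trace (transpose H ** (W ** X))"
    by (metis matrix_mul_assoc trace_mul_sym)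
  moreover have "trace (H ** transpose X ** W) = trace (transpose (H ** transpose X ** W))"
    by (simp add: trace_def transpose_def)
  moreover have "transpose (H ** transpose X ** W) = W ** X ** transpose H"
    using assms by (simp add: matrix_transpose_mul matrix_mul_assoc)
  moreover have "trace (W ** X ** transpose H) = trace (transpose H ** (W ** X))" by (rule trace_mul_sym)
  moreover have "mat t ** W = t *\<^sub>R W"
    by (subst mat_eq_scaleR) (simp add: matrix_mult_linear_simps)
  ultimately show ?thesis
    by (simp add: gp_cov_deriv_def matrix_mult_linear_simps trace_add trace_scaleR 1)
qed

theorem has_derivative_log_marginal:
  fixes Y :: "real^'m^'n" and X :: "real^'q^'n"
  assumes s: "s > 0"
  defines "W \<equiv> gp_gradient (sample_cov Y) X s"
  shows "((\<lambda>(X, s). log_marginal Y X s) has_derivative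
    (\<lambda>(H, t). - (real CARD('m) / 2) * (2 * (H \<bullet> (W ** X)) + t * trace W))) (at (X, s))"
proof -
  let ?K = "\<lambda>p::(real^'q^'n) \<times> real. gp_cov (fst p) (snd p)"
  let ?P = "matrix_inv (gp_cov X s)"
  let ?S = "sample_cov Y"
  have d: "det (gp_cov X s) \<noteq> 0" using gp_cov_det_pos[OF s, of X] by simp
  have "((\<lambda>p. \<Sum>j\<in>UNIV. (- 1 / 2) * (column j Y \<bullet> (matrix_inv (?K p) *v column j Y))
      - (1 / 2) * (real CARD('n) * ln (2 * pi) + ln (det (?K p)))) has_derivative
    (\<lambda>h. \<Sum>j\<in>(UNIV::'m set). (- 1 / 2) * (- (column j Y \<bullet> ((?P ** gp_cov_deriv X h ** ?P) *v column j Y)))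
      - (1 / 2) * (0 + trace (?P ** gp_cov_deriv X h)))) (at (X, s))"
    (is "(?F has_derivative ?F') _")
    by (intro derivative_intros has_derivative_ln_det_gp_cov has_derivative_inv_quadratic_gp_cov s)
  moreover have "?F' = (\<lambda>(H, t). - (real CARD('m) / 2) * (2 * (H \<bullet> (W ** X)) + t * trace W))"
  proof (rule ext, clarify)
    fix H t
    let ?E = "gp_cov_deriv X (H, t)"
    have "?F' (H, t) = (real CARD('m) / 2) * (trace (?P ** ?E ** ?P ** ?S) - trace (?P ** ?E))"
      using sum_column_quadratic[of Y "?P ** ?E ** ?P"]
      by (simp add: sum_subtractf sum_divide_distrib[symmetric] field_simps)
    moreover have "trace (?P ** ?E ** ?P ** ?S) = trace (?E ** (?P ** ?S ** ?P))"
      by (metis matrix_mul_assoc trace_mul_sym)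
    moreover have "trace (?P ** ?E) = trace (?E ** ?P)" by (rule trace_mul_sym)
    moreover have "W = ?P - ?P ** ?S ** ?P"
      using matrix_inv_mult[OF d]
      by (simp add: W_def gp_gradient_def matrix_mult_linear_simps)
    then have "trace (?E ** W) = trace (?E ** ?P) - trace (?E ** (?P ** ?S ** ?P))"
      by (simp add: matrix_mult_linear_simps trace_sub)
    moreover have "transpose W = W"
      unfolding W_def gp_gradient_def
      by (simp add: matrix_transpose_mul matrix_inv_symmetric[OF d gp_cov_symmetric] matrix_mul_assoc
          linear_diff[OF bounded_linear.linear[OF bounded_linear_transpose]] gp_cov_symmetric sample_cov_symmetric)
    then have "trace (?E ** W) = 2 * (H \<bullet> (W ** X)) + t * trace W"
      by (rule trace_mult_gp_cov_deriv)
    ultimately have "?F' (H, t) = (real CARD('m) / 2) * (- (2 * (H \<bullet> (W ** X)) + t * trace W))" by simp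
    then show "?F' (H, t) = - (real CARD('m) / 2) * (2 * (H \<bullet> (W ** X)) + t * trace W)"
      by (simp only: mult_minus_left mult_minus_right)
  qed
  ultimately have "(?F has_derivative (\<lambda>(H, t). - (real CARD('m) / 2) * (2 * (H \<bullet> (W ** X)) + t * trace W)))
      (at (X, s))" by simp
  \<comment> \<open>The closed formula represents \<open>log_marginal\<close> on the open half space
    of positive variance, which suffices for a derivative at \<open>(X, s)\<close>.\<close>
  then show ?thesis
    by (rule has_derivative_transform_within_open[OF _ open_snd_pos])
      (use s in \<open>auto simp: log_marginal_def gp_cov_def[symmetric] ln_gaussian_density gp_cov_det_pos\<close>)
qed

section \<open>Stationary points\<close>

lemma annihilator_mult_gp_cov:
  fixes X :: "real^'q^'n" and A :: "real^'n^'n"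
  assumes "A ** X = 0"
  shows "A ** gp_cov X s = s *\<^sub>R A"
proof -
  have "A ** (X ** transpose X) = 0" using assms by (simp add: matrix_mul_assoc)
  then show ?thesis
    by (simp add: gp_cov_def matrix_mult_linear_simps) (subst mat_eq_scaleR, simp add: matrix_mult_linear_simps)
qed

text \<open>The low rank part of the covariance is annihilated, so only the noise \<open>s I\<close>
  acts. Applied with \<open>A = K - S\<close>, also at a variance other than that of
  \<open>K\<close>, it removes inverses from the equations.\<close>

lemma annihilator_mult_inv:
  fixes X :: "real^'q^'n" and A :: "real^'n^'n"
  assumes "A ** X = 0" "s > 0"
  shows "A ** matrix_inv (gp_cov X s) = (1 / s) *\<^sub>R A"
proof -
  have d: "det (gp_cov X s) \<noteq> 0" using gp_cov_det_pos[OF assms(2), of X] by simp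
  have "A = A ** gp_cov X s ** matrix_inv (gp_cov X s)"
    using matrix_inv_mult(1)[OF d] by (simp add: matrix_mul_assoc[symmetric])
  also have "\<dots> = s *\<^sub>R (A ** matrix_inv (gp_cov X s))"
    by (simp add: annihilator_mult_gp_cov[OF assms(1)] matrix_mult_linear_simps)
  finally have "(1 / s) *\<^sub>R A = (1 / s) *\<^sub>R (s *\<^sub>R (A ** matrix_inv (gp_cov X s)))" by simp
  then show ?thesis using assms(2) by simp
qed

text \<open>Stationarity freed of matrix inverses. Both the parametrised stationary points and
  arbitrary joint local maxima are reduced to these two equations.\<close>

definition gp_critical :: "real^'n^'n \<Rightarrow> real^'q^'n \<Rightarrow> real \<Rightarrow> bool" where
  "gp_critical S X s \<longleftrightarrow> S ** X = gp_cov X s ** X \<and> trace S = trace (gp_cov X s)"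

text \<open>\<open>K - S\<close> annihilates \<open>X\<close>, so each of the two inverses in the
  gradient contributes a factor \<open>1 / s\<close>, the left one after transposing.\<close>

lemma gp_critical_gradient:
  fixes X :: "real^'q^'n"
  assumes s: "s > 0" and S: "transpose S = S" and SX: "S ** X = gp_cov X s ** X"
  shows "gp_gradient S X s = (1 / s\<^sup>2) *\<^sub>R (gp_cov X s - S)"
proof -
  let ?A = "gp_cov X s - S" and ?P = "matrix_inv (gp_cov X s)"
  have d: "det (gp_cov X s) \<noteq> 0" using gp_cov_det_pos[OF s, of X] by simp
  have AP: "?A ** ?P = (1 / s) *\<^sub>R ?A"
    by (rule annihilator_mult_inv) (use s SX in \<open>simp_all add: matrix_mult_linear_simps\<close>)
  have symA: "transpose ?A = ?A"
    by (simp add: linear_diff[OF bounded_linear.linear[OF bounded_linear_transpose]] gp_cov_symmetric S)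
  have "?P ** ?A = transpose (?A ** ?P)"
    by (simp add: matrix_transpose_mul symA matrix_inv_symmetric[OF d gp_cov_symmetric])
  also have "\<dots> = (1 / s) *\<^sub>R ?A" by (simp only: AP transpose_scalar symA)
  finally show ?thesis
    unfolding gp_gradient_def by (simp only: matrix_mult_linear_simps(5) AP)
      (simp add: power2_eq_square)
qed

text \<open>Write \<open>A = K - S\<close> and \<open>P = K^-1\<close>. Multiplying
  \<open>P A P X = 0\<close> by \<open>K\<close> shows that \<open>A P\<close> annihilates
  \<open>X\<close>; then \<open>A = A P K = s A P\<close>, hence \<open>A\<close> annihilates
  \<open>X\<close> as well.\<close>

lemma gp_gradient_zero_imp:
  fixes X :: "real^'q^'n"
  assumes s: "s > 0" and W: "gp_gradient S X s ** X = 0"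
  shows "S ** X = gp_cov X s ** X"
proof -
  let ?A = "gp_cov X s - S" and ?P = "matrix_inv (gp_cov X s)"
  have d: "det (gp_cov X s) \<noteq> 0" using gp_cov_det_pos[OF s, of X] by simp
  have "?A ** ?P ** X = gp_cov X s ** (gp_gradient S X s ** X)"
    using matrix_inv_mult(1)[OF d] by (simp add: gp_gradient_def matrix_mul_assoc)
  then have APX: "?A ** ?P ** X = 0" using W by simp
  have "?A = ?A ** ?P ** gp_cov X s"
    using matrix_inv_mult(2)[OF d] by (simp add: matrix_mul_assoc[symmetric])
  also have "\<dots> = s *\<^sub>R (?A ** ?P)" by (rule annihilator_mult_gp_cov[OF APX])
  finally have "?A ** X = s *\<^sub>R (?A ** ?P ** X)" by (metis matrix_mult_linear_simps(5))
  then show ?thesis by (simp add: APX) (simp add: matrix_mult_linear_simps)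
qed

lemma gp_critical_iff_stationary:
  fixes Y :: "real^'m^'n" and X :: "real^'q^'n"
  assumes s: "s > 0"
  shows "gp_critical (sample_cov Y) X s
    \<longleftrightarrow> stationary_point (\<lambda>(X, s). log_marginal Y X s) (X, s)"
proof
  let ?S = "sample_cov Y" and ?W = "gp_gradient (sample_cov Y) X s"
  note D = has_derivative_log_marginal[OF s, of Y X]
  note G = gp_critical_gradient[OF s sample_cov_symmetric]
  {
    assume *: "gp_critical ?S X s"
    then have W: "?W = (1 / s\<^sup>2) *\<^sub>R (gp_cov X s - ?S)" by (intro G) (simp add: gp_critical_def)
    have "?W ** X = 0" "trace ?W = 0"
      using * by (simp_all add: W gp_critical_def matrix_mult_linear_simps trace_scaleR trace_sub)
    with D show "stationary_point (\<lambda>(X, s). log_marginal Y X s) (X, s)"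
      by (simp add: stationary_point_def case_prod_unfold)
  next
    assume "stationary_point (\<lambda>(X, s). log_marginal Y X s) (X, s)"
    then have "(\<lambda>(H, t). - (real CARD('m) / 2) * (2 * (H \<bullet> (?W ** X)) + t * trace ?W)) = (\<lambda>_. 0)"
      using D has_derivative_unique unfolding stationary_point_def by blast
    from fun_cong[OF this] have *: "2 * (H \<bullet> (?W ** X)) + t * trace ?W = 0" for H t by auto
    \<comment> \<open>The direction \<open>H = W X\<close> tests the gradient against
      itself.\<close>
    from *[of "?W ** X" 0] have SX: "?S ** X = gp_cov X s ** X"
      by (intro gp_gradient_zero_imp[OF s]) simp
    from *[of 0 1] have "trace ?W = 0" by simp
    then have "trace ?S = trace (gp_cov X s)" using s by (simp add: G[OF SX] trace_scaleR trace_sub)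
    with SX show "gp_critical ?S X s" by (simp add: gp_critical_def)
  }
qed

text \<open>\<open>K - S\<close> annihilates \<open>X\<close> and has trace zero, so exchanging
  \<open>S\<close> for the covariance at \<open>(X, s)\<close> leaves the trace term unchanged at
  every variance \<open>s'\<close>.\<close>

lemma gp_critical_cost:
  fixes X :: "real^'q^'n"
  assumes crit: "gp_critical S X s" and s': "s' > 0"
  shows "gp_cost S X s' = ln (det (gp_cov X s')) + trace (matrix_inv (gp_cov X s') ** gp_cov X s)"
proof -
  let ?A = "gp_cov X s - S" and ?P = "matrix_inv (gp_cov X s')"
  have "?A ** ?P = (1 / s') *\<^sub>R ?A"
    by (rule annihilator_mult_inv)
      (use s' crit in \<open>simp_all add: matrix_mult_linear_simps gp_critical_def\<close>)
  then have "trace (?P ** ?A) = trace ((1 / s') *\<^sub>R ?A)" by (metis trace_mul_sym)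
  also have "\<dots> = 0" using crit by (simp add: trace_scaleR trace_sub gp_critical_def)
  finally show ?thesis by (simp add: gp_cost_def matrix_mult_linear_simps trace_sub)
qed

text \<open>Raising the variance by \<open>t\<close> shifts every eigenvalue by \<open>t\<close> in
  the same eigenbasis. With \<open>S\<close> exchanged for the covariance, the cost splits into
  scalar costs, each strictly minimal at \<open>t = 0\<close>.\<close>

lemma gp_critical_not_local_min:
  fixes Y :: "real^'m^'n" and X :: "real^'q^'n"
  assumes crit: "gp_critical (sample_cov Y) X s" and s: "s > 0"
  shows "\<not> local_min (\<lambda>(X, s). log_marginal Y X s) (X, s)"
proof
  assume "local_min (\<lambda>(X, s). log_marginal Y X s) (X, s)"
  then obtain d where d: "d > 0"
    "\<And>q. dist q (X, s) < d \<Longrightarrow> log_marginal Y X s \<le> (case q of (X, s) \<Rightarrow> log_marginal Y X s)"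
    by (auto simp: local_min_def eventually_nhds_metric)
  define t where "t = d / 2"
  have t: "t > 0" "s + t > 0" using d(1) s by (simp_all add: t_def)
  have "dist (X, s + t) (X, s) < d" using d(1) by (simp add: dist_Pair_Pair dist_real_def t_def)
  from d(2)[OF this] have "gp_cost (sample_cov Y) X (s + t) \<le> gp_cost (sample_cov Y) X s"
    using log_marginal_le_iff[of "s + t" s Y X X] t s by simp
  moreover obtain f k where f: "eigenbasis (gp_cov X s) f k" "\<And>i. k i > 0"
    using gp_cov_eigenbasis[OF s] by metis
  have "gp_cov X (s + t) = 1 *\<^sub>R gp_cov X s + mat t"
    by (simp add: gp_cov_def mat_def vec_eq_iff)
  then have ft: "eigenbasis (gp_cov X (s + t)) f (\<lambda>i. k i + t)"
    using eigenbasis_add_mat[OF f(1), of 1 t] by simp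
  have kt: "k i + t > 0" for i using f(2)[of i] t by simp
  have "gp_cost (sample_cov Y) X s = (\<Sum>i\<in>UNIV. ln (k i) + 1)"
    using f(2) by (simp add: gp_critical_cost[OF crit s] eigenbasis_ln_det[OF f] sum.distrib
        eigenbasis_trace_inv_mult[OF f] eigenbasis_mult[OF f(1)] eigenbasis_inner[OF f(1)]
        less_imp_neq[symmetric])
  also have "\<dots> < (\<Sum>i\<in>UNIV. ln (k i + t) + k i / (k i + t))"
    using f(2) kt t by (intro sum_strict_mono ln_add_div_gt) auto
  also have "\<dots> = gp_cost (sample_cov Y) X (s + t)"
    by (simp add: gp_critical_cost[OF crit t(2)] eigenbasis_ln_det[OF ft kt] sum.distrib
        eigenbasis_trace_inv_mult[OF ft kt] eigenbasis_mult[OF f(1)] eigenbasis_inner[OF f(1)])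
  ultimately show False by simp
qed

section \<open>Rank one perturbations of the covariance\<close>

definition outer :: "real^'n \<Rightarrow> real^'q \<Rightarrow> real^'q^'n" where
  "outer u z = (\<chi> i j. u $ i * z $ j)"

lemma outer_mult: "outer u z *v x = (z \<bullet> x) *\<^sub>R u"
  by (simp add: outer_def vec_eq_iff matrix_vector_mult_def inner_vec_def sum_distrib_left
      sum_distrib_right mult_ac)

lemma mult_outer: "x v* outer u z = (u \<bullet> x) *\<^sub>R z"
  by (simp add: outer_def vec_eq_iff vector_matrix_mult_def inner_vec_def sum_distrib_left
      sum_distrib_right mult_ac)

lemma trace_outer_mult: "trace (outer u u ** S) = u \<bullet> (S *v u)"
  by (subst trace_mul_sym)
    (simp add: trace_def outer_def matrix_matrix_mult_def matrix_vector_mult_def inner_vec_def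
      sum_distrib_left mult_ac)

lemma vector_matrix_mult_linear:
  "x v* (A + B) = x v* A + x v* (B :: real^'m^'n)" "x v* (A - B) = x v* A - x v* (B :: real^'m^'n)"
  "(x + y) v* A = x v* A + y v* (A :: real^'m^'n)" "(c *\<^sub>R x) v* A = c *\<^sub>R (x v* (A :: real^'m^'n))"
  by (simp_all add: vector_matrix_mult_def vec_eq_iff sum.distrib sum_subtractf sum_distrib_left
      algebra_simps)

text \<open>The matrix is read as a covariance with a single latent coordinate and unit noise: at
  most one eigenvalue differs from 1, and the trace determines it.\<close>

lemma det_id_plus_outer:
  fixes u :: "real^'n"
  assumes c: "c \<ge> 0" and u: "u \<bullet> u = 1"
  shows "det (mat 1 + c *\<^sub>R outer u u) = 1 + c"
proof -
  define X :: "real^1^'n" where "X = outer (sqrt c *\<^sub>R u) (vec 1)"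
  have X: "gp_cov X 1 = mat 1 + c *\<^sub>R outer u u"
    using c by (simp add: X_def gp_cov_def outer_def vec_eq_iff matrix_matrix_mult_def transpose_def)
  obtain f k where f: "eigenbasis (gp_cov X 1) f k" "\<And>i. k i \<ge> 1"
    using gp_cov_eigenbasis[of 1 X, OF zero_less_one] by metis
  let ?J = "{i. k i \<noteq> 1}"
  have "(\<Sum>i\<in>UNIV. k i) = trace (gp_cov X 1)"
    by (simp add: eigenbasis_trace[OF f(1)] eigenbasis_mult[OF f(1)] eigenbasis_inner[OF f(1)])
  also have "\<dots> = real CARD('n) + c * trace (outer u u)"
    unfolding X trace_add trace_I trace_scaleR ..
  also have "trace (outer u u) = 1"
    using u by (simp add: trace_def outer_def inner_vec_def)
  finally have "(\<Sum>i\<in>UNIV. k i - 1) = c" by (simp add: sum_subtractf)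
  also have "(\<Sum>i\<in>UNIV. k i - 1) = (\<Sum>i\<in>?J. k i - 1)"
    by (rule sum.mono_neutral_right) auto
  finally have sum: "(\<Sum>i\<in>?J. k i - 1) = c" .
  have "det (mat 1 + c *\<^sub>R outer u u) = (\<Prod>i\<in>UNIV. k i)" using eigenbasis_det[OF f(1)] X by simp
  also have "\<dots> = (\<Prod>i\<in>?J. k i)" by (rule prod.mono_neutral_right) auto
  finally have det: "det (mat 1 + c *\<^sub>R outer u u) = (\<Prod>i\<in>?J. k i)" .
  have "card ?J \<le> 1" using gp_cov_card_le[OF f(1)] by simp
  then consider "?J = {}" | i where "?J = {i}"
    by (metis card_0_eq card_1_singletonE finite le_less less_one)
  then show ?thesis
  proof cases
    case 1
    show ?thesis using sum det unfolding 1 by simp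
  next
    case 2
    show ?thesis using sum det unfolding 2 by simp
  qed
qed

text \<open>The matrix determinant lemma and the Sherman-Morrison formula, simplified by
  \<open>u\<close> being an eigenvector: its eigenvalue moves from \<open>s\<close> to
  \<open>s + a\<close>, and the coefficient \<open>a / (s * (s + a))\<close> is
  \<open>1 / s - 1 / (s + a)\<close>.\<close>

lemma rank_one_update:
  fixes K :: "real^'n^'n"
  assumes K: "det K > 0" "transpose K = K" "K *v u = s *\<^sub>R u" and s: "s > 0" and a: "a \<ge> 0" and u: "u \<bullet> u = 1"
  shows "det (K + a *\<^sub>R outer u u) = det K * (1 + a / s)"
    "matrix_inv (K + a *\<^sub>R outer u u) = matrix_inv K - (a / (s * (s + a))) *\<^sub>R outer u u"
proof -
  have "K + a *\<^sub>R outer u u = K ** (mat 1 + (a / s) *\<^sub>R outer u u)"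
    using s K(3) by (simp add: matrix_eq matrix_vector_mult_add_rdistrib outer_mult scaleR_matrix_vector_assoc[symmetric]
        matrix_vector_mul_assoc[symmetric] matrix_vector_right_distrib matrix_vector_mult_scaleR)
  then show "det (K + a *\<^sub>R outer u u) = det K * (1 + a / s)"
    using det_id_plus_outer[of "a / s" u] s a u by (simp add: det_mul)
  have d: "det K \<noteq> 0" using K(1) by simp
  note P = matrix_inv_mult[OF d]
  have "u = s *\<^sub>R (matrix_inv K *v u)"
    using arg_cong[OF K(3), of "(*v) (matrix_inv K)"] P(2)
    by (simp add: matrix_vector_mul_assoc matrix_vector_mult_scaleR)
  then have uP: "u \<bullet> x = s * (u \<bullet> (matrix_inv K *v x))" for x
    using symmetric_dot[OF matrix_inv_symmetric[OF d K(2)], of u x] by (metis inner_scaleR_left)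
  have "(K + a *\<^sub>R outer u u) ** (matrix_inv K - (a / (s * (s + a))) *\<^sub>R outer u u) = mat 1"
  proof (simp only: matrix_eq, intro allI)
    fix x
    define p where "p = u \<bullet> (matrix_inv K *v x)"
    have "((K + a *\<^sub>R outer u u) ** (matrix_inv K - (a / (s * (s + a))) *\<^sub>R outer u u)) *v x
      = x + (a * p - a / (s * (s + a)) * (s * p) * s - a * (a / (s * (s + a)) * (s * p))) *\<^sub>R u"
      using P(1) K(3) u unfolding p_def
      by (simp add: matrix_vector_mul_assoc[symmetric] matrix_vector_mult_add_rdistrib outer_mult
          matrix_vector_mult_diff_rdistrib matrix_vector_mult_diff_distrib
          scaleR_matrix_vector_assoc[symmetric] inner_diff_right matrix_vector_mult_scaleR
          uP[of x] scaleR_diff_left scaleR_diff_right algebra_simps)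
        (simp add: matrix_vector_mul_assoc)
    also have "a * p - a / (s * (s + a)) * (s * p) * s - a * (a / (s * (s + a)) * (s * p)) = 0"
      using s a by (simp add: divide_simps) (simp add: algebra_simps)
    finally show "((K + a *\<^sub>R outer u u) ** (matrix_inv K - (a / (s * (s + a))) *\<^sub>R outer u u)) *v x = mat 1 *v x"
      by simp
  qed
  then show "matrix_inv (K + a *\<^sub>R outer u u) = matrix_inv K - (a / (s * (s + a))) *\<^sub>R outer u u"
    by (rule matrix_inv_unique)
qed

text \<open>\<open>X z = 0\<close> removes the mixed terms, so the covariance gains exactly
  \<open>(z \<bullet> z) u u^T\<close>. Both perturbations that are tested against a local maximum
  have this form.\<close>

lemma gp_cost_add_outer:
  fixes X :: "real^'q^'n"
  assumes s: "s > 0" and u: "u \<bullet> u = 1" "u v* X = 0" and z: "X *v z = 0"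
  shows "gp_cost S (X + outer u z) s
    = gp_cost S X s + ln (1 + z \<bullet> z / s) - (z \<bullet> z) / (s * (s + z \<bullet> z)) * (u \<bullet> (S *v u))"
proof -
  have "gp_cov (X + outer u z) s *v x = (gp_cov X s + (z \<bullet> z) *\<^sub>R outer u u) *v x" for x
  proof -
    have "z \<bullet> (x v* X) = 0" using inner_matrix_mult[of x X z] z by (simp add: inner_commute)
    then show ?thesis using z
      by (simp add: gp_cov_mult matrix_vector_mult_add_rdistrib matrix_vector_right_distrib
          vector_matrix_mult_linear mult_outer outer_mult scaleR_matrix_vector_assoc[symmetric]
          inner_add_right matrix_vector_mult_scaleR)
  qed
  then have K: "gp_cov (X + outer u z) s = gp_cov X s + (z \<bullet> z) *\<^sub>R outer u u" by (simp add: matrix_eq)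
  have "gp_cov X s *v u = s *\<^sub>R u" using u(2) by (simp add: gp_cov_mult)
  from rank_one_update[where a = "z \<bullet> z", OF gp_cov_det_pos[OF s] gp_cov_symmetric this s inner_ge_zero u(1)]
  moreover have "1 + z \<bullet> z / s > 0" using s by (simp add: add_pos_nonneg)
  ultimately show ?thesis
    using gp_cov_det_pos[OF s, of X]
    by (simp add: gp_cost_def K matrix_mult_linear_simps trace_sub trace_scaleR trace_outer_mult
        ln_mult)
qed

section \<open>Local maxima\<close>

lemma local_max_along:
  assumes "local_max f x" "(g \<longlongrightarrow> x) F"
  shows "\<forall>\<^sub>F t in F. f (g t) \<le> f x"
  using assms unfolding local_max_def by (rule eventually_compose_filterlim)

lemma tendsto_outer:
  assumes "(f \<longlongrightarrow> a) F" "(g \<longlongrightarrow> b) F"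
  shows "((\<lambda>t. outer (f t) (g t)) \<longlongrightarrow> outer a b) F"
  unfolding outer_def using assms by (intro tendsto_vec_lambda tendsto_mult tendsto_vec_nth)

lemma local_max_log_marginal_along:
  fixes Y :: "real^'m^'n"
  assumes "s > 0" "local_max (\<lambda>X. log_marginal Y X s) X" "(g \<longlongrightarrow> X) F"
  shows "\<forall>\<^sub>F t in F. gp_cost (sample_cov Y) X s \<le> gp_cost (sample_cov Y) (g t) s"
  using local_max_along[OF assms(2,3)]
  by (rule eventually_mono) (simp add: log_marginal_le_iff[OF assms(1,1)])

text \<open>Activate the free latent direction with a small amplitude \<open>t\<close>. Local
  maximality bounds \<open>t^2 / (s (s + t^2))\<close> times the variance along \<open>w\<close> by
  \<open>ln (1 + t^2 / s)\<close>, and \<open>ln (1 + x) \<le> x\<close> turns this into the bound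
  \<open>s + t^2\<close>.\<close>

lemma local_max_bound_rank_deficient:
  fixes Y :: "real^'m^'n" and X :: "real^'q^'n"
  assumes s: "s > 0" and max: "local_max (\<lambda>X. log_marginal Y X s) X"
    and z: "norm z = 1" "X *v z = 0" and w: "w \<bullet> w = 1" "w v* X = 0"
  shows "w \<bullet> (sample_cov Y *v w) \<le> s"
proof (rule tendsto_lowerbound)
  let ?c = "w \<bullet> (sample_cov Y *v w)"
  have zz: "z \<bullet> z = 1" using z(1) by (simp add: dot_square_norm)
  have "((\<lambda>t. X + outer w (t *\<^sub>R z)) \<longlongrightarrow> X + outer w (0 *\<^sub>R z)) (at_right 0)"
    by (intro tendsto_intros tendsto_outer)
  moreover have "X + outer w (0 *\<^sub>R z) = X" by (simp add: outer_def vec_eq_iff)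
  ultimately have "((\<lambda>t. X + outer w (t *\<^sub>R z)) \<longlongrightarrow> X) (at_right 0)" by simp
  from local_max_log_marginal_along[OF s max this]
  show "\<forall>\<^sub>F t in at_right 0. ?c \<le> s + t\<^sup>2"
    using eventually_at_right_less[of "0::real"]
  proof eventually_elim
    case (elim t)
    have Xt: "X *v (t *\<^sub>R z) = 0" using z(2) by (simp add: matrix_vector_mult_scaleR)
    have tt: "(t *\<^sub>R z) \<bullet> (t *\<^sub>R z) = t\<^sup>2" by (simp add: zz power2_eq_square)
    have pos: "t\<^sup>2 > 0" "s * (s + t\<^sup>2) > 0" using elim s by (simp_all add: add_pos_pos)
    have "t\<^sup>2 / (s * (s + t\<^sup>2)) * ?c \<le> ln (1 + t\<^sup>2 / s)"
      using elim(1) unfolding gp_cost_add_outer[OF s w Xt] tt by simp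
    also have "\<dots> \<le> t\<^sup>2 / s" using pos s by (intro ln_add_one_self_le_self) simp
    also have "\<dots> = t\<^sup>2 / (s * (s + t\<^sup>2)) * (s + t\<^sup>2)" using pos s by (simp add: field_simps)
    finally show ?case by (rule mult_left_le_imp_le) (use pos in simp)
  qed
  show "((\<lambda>t. s + t\<^sup>2) \<longlongrightarrow> s) (at_right 0)" by (auto intro!: tendsto_eq_intros)
qed simp

text \<open>Rotating the eigenvector \<open>f\<close> towards \<open>w\<close> keeps the spectrum of the covariance.\<close>

lemma local_max_bound_retained:
  fixes Y :: "real^'m^'n" and X :: "real^'q^'n"
  assumes s: "s > 0" and max: "local_max (\<lambda>X. log_marginal Y X s) X"
    and f: "f \<bullet> f = 1" "gp_cov X s *v f = k *\<^sub>R f" "sample_cov Y *v f = k *\<^sub>R f" and k: "s < k"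
    and w: "w \<bullet> w = 1" "w v* X = 0"
  shows "w \<bullet> (sample_cov Y *v w) \<le> k"
proof -
  let ?S = "sample_cov Y"
  define g where "g = f v* X"
  \<comment> \<open>\<open>X\<close> is the rank one update of \<open>X0\<close> by \<open>f\<close>
    and \<open>g\<close>. Since \<open>f\<close> and \<open>w\<close> are orthogonal to the range of
    \<open>X0\<close> and \<open>X0\<close> annihilates \<open>g\<close>, replacing \<open>f\<close>
    by any unit vector in the plane of \<open>f\<close> and \<open>w\<close> is covered by
    \<open>gp_cost_add_outer\<close>.\<close>
  define X0 where "X0 = X - outer f g"
  have Xg: "X *v g = (k - s) *\<^sub>R f" using f(2) by (simp add: gp_cov_mult g_def algebra_simps)
  have "g \<bullet> g = f \<bullet> (X *v g)" using inner_matrix_mult[of f X g] by (simp add: g_def)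
  also have "\<dots> = k - s" by (simp add: Xg f(1))
  finally have gg: "g \<bullet> g = k - s" .
  have X0g: "X0 *v g = 0"
    by (simp add: X0_def matrix_vector_mult_diff_rdistrib outer_mult Xg gg)
  have "(k - s) * (w \<bullet> f) = w \<bullet> (X *v g)" by (simp add: Xg)
  also have "\<dots> = 0" using w(2) by (simp add: inner_matrix_mult)
  finally have wf: "w \<bullet> f = 0" using k by simp
  have fX0: "f v* X0 = 0" by (simp add: X0_def vector_matrix_mult_linear mult_outer f(1) g_def)
  have wX0: "w v* X0 = 0" by (simp add: X0_def vector_matrix_mult_linear mult_outer wf w(2) inner_commute[of f])
  define u where "u t = cos t *\<^sub>R f + sin t *\<^sub>R w" for t
  have uX0: "u t v* X0 = 0" for t by (simp add: u_def vector_matrix_mult_linear fX0 wX0)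
  have uu: "u t \<bullet> u t = 1" for t
    using sin_cos_squared_add2[of t] f(1) w(1) wf
    by (simp add: u_def inner_add_left inner_add_right inner_commute power2_eq_square)
  have wSf: "w \<bullet> (?S *v f) = 0" "f \<bullet> (?S *v w) = 0"
    using symmetric_dot[OF sample_cov_symmetric, of Y f w] f(3) wf by (simp_all add: inner_commute)
  have uSu: "u t \<bullet> (?S *v u t) = (cos t)\<^sup>2 * k + (sin t)\<^sup>2 * (w \<bullet> (?S *v w))" for t
    using wSf f(1,3)
    by (simp add: u_def matrix_vector_right_distrib matrix_vector_mult_scaleR inner_add_left
        inner_add_right power2_eq_square) (use wf in \<open>simp add: inner_commute\<close>)
  have u0: "u 0 = f" by (simp add: u_def)
  have "((\<lambda>t. X0 + outer (u t) g) \<longlongrightarrow> X0 + outer (u 0) g) (at_right 0)"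
    unfolding u_def by (intro tendsto_intros tendsto_outer)
  then have lim: "((\<lambda>t. X0 + outer (u t) g) \<longlongrightarrow> X) (at_right 0)" by (simp add: u0 X0_def)
  have "\<forall>\<^sub>F t in at_right 0. t \<in> {0<..<pi}"
    by (rule eventually_at_right_real) simp
  with local_max_log_marginal_along[OF s max lim]
  have "\<forall>\<^sub>F t in at_right (0::real). gp_cost ?S X s \<le> gp_cost ?S (X0 + outer (u t) g) s \<and> t \<in> {0<..<pi}"
    by (rule eventually_conj)
  \<comment> \<open>One \<open>t\<close> with \<open>sin t\<close> nonzero is enough, because the
    quadratic form of \<open>S\<close> along the rotation is affine in
    \<open>(sin t)^2\<close>.\<close>
  then obtain t where t: "gp_cost ?S X s \<le> gp_cost ?S (X0 + outer (u t) g) s" "0 < t" "t < pi"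
    using eventually_happens[of _ "at_right (0::real)"] by auto
  have "X = X0 + outer (u 0) g" by (simp add: u0 X0_def)
  with t(1) have "gp_cost ?S (X0 + outer (u 0) g) s \<le> gp_cost ?S (X0 + outer (u t) g) s" by simp
  \<comment> \<open>The amplitude \<open>g\<close> does not change, so the logarithms and the cost
    of \<open>X0\<close> cancel; \<open>s + g \<bullet> g = k\<close> explains the
    coefficient.\<close>
  then have "(k - s) / (s * k) * (u t \<bullet> (?S *v u t)) \<le> (k - s) / (s * k) * (u 0 \<bullet> (?S *v u 0))"
    unfolding gp_cost_add_outer[OF s uu uX0 X0g] gg by simp
  moreover have "(k - s) / (s * k) > 0" using k s by simp
  ultimately have "u t \<bullet> (?S *v u t) \<le> k" by (simp only: mult_le_cancel_left_pos uSu) simp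
  then have "(sin t)\<^sup>2 * (w \<bullet> (?S *v w)) \<le> (1 - (cos t)\<^sup>2) * k" by (simp add: uSu algebra_simps)
  then have "(sin t)\<^sup>2 * (w \<bullet> (?S *v w)) \<le> (sin t)\<^sup>2 * k" by (simp only: sin_squared_eq)
  then show ?thesis using sin_gt_zero[OF t(2,3)] by simp
qed

lemma quadratic_bound_normalize:
  fixes S :: "real^'n^'n" and X :: "real^'q^'n"
  assumes "\<And>w. w \<bullet> w = 1 \<Longrightarrow> w v* X = 0 \<Longrightarrow> w \<bullet> (S *v w) \<le> c" and "w v* X = 0"
  shows "w \<bullet> (S *v w) \<le> c * (w \<bullet> w)"
proof (cases "w = 0")
  case False
  let ?v = "inverse (norm w) *\<^sub>R w"
  have "?v \<bullet> ?v = 1" using False by (simp add: dot_square_norm power2_eq_square)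
  moreover have "?v v* X = 0" using assms(2) by (simp add: vector_matrix_mult_linear)
  ultimately have "?v \<bullet> (S *v ?v) \<le> c" by (rule assms(1))
  then show ?thesis using False
    by (simp add: matrix_vector_mult_scaleR dot_square_norm field_simps power2_eq_square)
qed simp

text \<open>Local maximality in \<open>X\<close> alone supplies the bound \<open>\<kappa>\<close>
  required by \<open>gp_cost_lower_bound\<close>; optimality in the variance is carried by the trace
  equation in \<open>gp_critical\<close>.\<close>

theorem critical_local_max_imp_global_max:
  fixes Y :: "real^'m^'n" and X :: "real^'q^'n"
  assumes s: "s > 0" and crit: "gp_critical (sample_cov Y) X s"
    and max: "local_max (\<lambda>X. log_marginal Y X s) X"
  shows "global_max Y X s"
proof -
  let ?S = "sample_cov Y"
  obtain f k where f: "eigenbasis (gp_cov X s) f k" "\<And>i. k i \<ge> s"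
    using gp_cov_eigenbasis[OF s] by metis
  let ?J = "{i. k i \<noteq> s}"
  have ff: "f i \<bullet> f i = 1" for i using eigenbasis_inner[OF f(1)] by simp
  have retained: "w \<bullet> (?S *v w) \<le> k i" if i: "k i \<noteq> s" and w: "w \<bullet> w = 1" "w v* X = 0" for i w
  proof (rule local_max_bound_retained[OF s max ff eigenbasis_mult[OF f(1)] _ _ w])
    show "s < k i" using f(2)[of i] i by simp
    have "?S *v (X *v y) = gp_cov X s *v (X *v y)" for y
      using crit by (simp add: gp_critical_def matrix_vector_mul_assoc)
    then show "?S *v f i = k i *\<^sub>R f i"
      using gp_cov_range[OF f(1) i] eigenbasis_mult[OF f(1), of i] by metis
  qed
  \<comment> \<open>The value is \<open>s\<close> when a latent direction is free, and otherwise the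
    least retained eigenvalue, which exists because there is at least one latent coordinate.\<close>
  obtain \<kappa> where \<kappa>: "s \<le> \<kappa>" "\<And>j. k j \<noteq> s \<Longrightarrow> \<kappa> \<le> k j" "card ?J < CARD('q) \<Longrightarrow> \<kappa> = s"
    "\<And>w. w \<bullet> w = 1 \<Longrightarrow> w v* X = 0 \<Longrightarrow> w \<bullet> (?S *v w) \<le> \<kappa>"
  proof (cases "card ?J < CARD('q)")
    case True
    then obtain z where "norm z = 1" "X *v z = 0" using gp_cov_kernel[OF f(1)] by blast
    from local_max_bound_rank_deficient[OF s max this] show ?thesis using f(2) by (intro that[of s]) auto
  next
    case False
    then have "card ?J > 0" using zero_less_card_finite[where 'a = 'q] by linarith
    then have "k ` ?J \<noteq> {}" by (simp add: card_gt_0_iff)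
    then have "Min (k ` ?J) \<in> k ` ?J" by (intro Min_in) auto
    then obtain i where "k i \<noteq> s" "k i = Min (k ` ?J)" by auto
    with False show ?thesis
      by (intro that[of "k i"] f(2) retained) (auto intro: Min_le)
  qed
  have "ln (det (gp_cov X s)) + real CARD('n) = gp_cost ?S X s"
    using gp_cov_det_pos[OF s, of X] by (simp add: gp_critical_cost[OF crit s] trace_inv_self)
  moreover have "ln (det (gp_cov X s)) + real CARD('n) \<le> gp_cost ?S X' s'" if "s' > 0" for X' :: "real^'q^'n" and s'
    unfolding gp_cost_def using crit
    by (intro gp_cost_lower_bound[OF f(1) s that sample_cov_symmetric _ _ \<kappa>(1,2) quadratic_bound_normalize[OF \<kappa>(4)] \<kappa>(3)])
      (simp_all add: gp_critical_def)
  ultimately show ?thesis using s by (simp add: global_max_def log_marginal_le_iff)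
qed

section \<open>From the parametrised stationary points to the critical equations\<close>

lemma has_real_derivative_prod_one_minus:
  fixes c :: "'i \<Rightarrow> real"
  assumes "finite I"
  shows "((\<lambda>t. \<Prod>i\<in>I. 1 - t * c i) has_real_derivative - (\<Sum>i\<in>I. c i)) (at 0)"
  using assms
proof (induction I rule: finite_induct)
  case (insert i I)
  have "((\<lambda>t. 1 - t * c i) has_real_derivative - c i) (at 0)" by (auto intro!: derivative_eq_intros)
  from DERIV_mult[OF this insert.IH] show ?case using insert.hyps by simp
qed simp

text \<open>Substituting \<open>x = 1 / t\<close> in the characteristic polynomial and clearing
  denominators gives a product of factors \<open>1 - t * c\<close>, whose derivative at 0 is minus
  the sum of the roots. This compares the sums without matching individual roots.\<close>

lemma lists_eigenvalues_trace:
  fixes A :: "real^'n^'n"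
  assumes sym: "transpose A = A" and \<nu>: "lists_eigenvalues A \<nu>"
  shows "trace A = (\<Sum>j=1..CARD('n). \<nu> j)"
proof -
  obtain e k where e: "eigenbasis A e k" using symmetric_eigenbasis[OF sym] by blast
  have char: "(\<Prod>i\<in>UNIV. x - k i) = (\<Prod>j=1..CARD('n). x - \<nu> j)" for x
  proof -
    have "mat x - A = (- 1) *\<^sub>R A + mat x" by simp
    then have "det (mat x - A) = (\<Prod>i\<in>UNIV. x - k i)"
      using eigenbasis_det[OF eigenbasis_add_mat[OF e, of "-1" x]] by simp
    then show ?thesis using \<nu> by (simp add: lists_eigenvalues_def)
  qed
  have "(\<Prod>i\<in>UNIV. 1 - t * k i) = (\<Prod>j=1..CARD('n). 1 - t * \<nu> j)" for t
  proof (cases "t = 0")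
    case False
    then have t: "1 - t * c = t * (1 / t - c)" for c by (simp add: field_simps)
    show ?thesis unfolding t prod.distrib char by simp
  qed simp
  then have "(\<Sum>i\<in>UNIV. k i) = (\<Sum>j=1..CARD('n). \<nu> j)"
    using DERIV_unique[OF has_real_derivative_prod_one_minus[of "UNIV :: 'n set" k]]
      has_real_derivative_prod_one_minus[of "{1..CARD('n)}" \<nu>] by force
  then show ?thesis
    by (simp add: eigenbasis_trace[OF e] eigenbasis_mult[OF e] eigenbasis_inner[OF e])
qed

lemma diag_matrix_simps:
  fixes a b :: "'q::finite \<Rightarrow> real"
  shows "diag_matrix a ** diag_matrix b = diag_matrix (\<lambda>i. a i * b i)"
    "diag_matrix a + diag_matrix b = diag_matrix (\<lambda>i. a i + b i)"
    "c *\<^sub>R diag_matrix a = diag_matrix (\<lambda>i. c * a i)"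
    "transpose (diag_matrix a) = diag_matrix a"
    "trace (diag_matrix a) = (\<Sum>i\<in>UNIV. a i)"
proof -
  have mult: "(\<Sum>k\<in>UNIV. (if i = k then a i else 0) * (if k = j then b k else 0)) = (if i = j then a i * b i else 0)" for i j
  proof -
    have "(if i = k then a i else 0) * (if k = j then b k else 0) = (if i = k then (if i = j then a i * b i else 0) else 0)" for k
      by auto
    then show ?thesis by simp
  qed
  show "diag_matrix a ** diag_matrix b = diag_matrix (\<lambda>i. a i * b i)"
    by (simp add: diag_matrix_def vec_eq_iff matrix_matrix_mult_def mult)
qed (simp_all add: diag_matrix_def vec_eq_iff transpose_def trace_def)

lemma ml_stationary_point_imp_critical:
  fixes Y :: "real^'m^'n" and X :: "real^'q^'n"
  assumes ml: "ml_stationary_point Y X s" and card: "CARD('q) < CARD('n)"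
  shows "gp_critical (sample_cov Y) X s"
proof -
  let ?S = "sample_cov Y"
  obtain U \<mu> l R \<nu> \<pi> where s: "s > 0" and form: "stationary_form Y s U \<mu> l R X"
    and \<nu>: "lists_eigenvalues ?S \<nu>" and \<pi>: "bij_betw \<pi> (retained s l) {1..card (retained s l)}"
      "\<forall>i\<in>retained s l. \<nu> (\<pi> i) = l i"
    and ml: "s = (\<Sum>j = card (retained s l) + 1..CARD('n). \<nu> j) / real (CARD('n) - card (retained s l))"
    using ml by (auto simp: ml_stationary_point_def)
  define d where "d i = sqrt (l i - s)" for i
  let ?D = "diag_matrix d"
  have U: "transpose U ** U = mat 1" and SU: "\<And>i. ?S *v column i U = \<mu> i *\<^sub>R column i U"
    and l: "\<And>i. (l i = \<mu> i \<and> \<mu> i > s) \<or> l i = s" and R: "transpose R ** R = mat 1" "R ** transpose R = mat 1"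
    and X: "X = U ** ?D ** R"
    using form by (auto simp: stationary_form_def orthogonal_matrix_def d_def[abs_def])
  have dd: "d i * d i = l i - s" for i using l[of i] by (auto simp: d_def)
  have SUM: "?S ** U = U ** diag_matrix \<mu>"
  proof (simp add: vec_eq_iff, intro allI)
    fix i j
    have "(?S ** U) $ i $ j = (?S *v column j U) $ i"
      by (simp add: matrix_matrix_mult_def matrix_vector_mult_def column_def)
    also have "\<dots> = U $ i $ j * \<mu> j" unfolding SU by (simp add: column_def)
    also have "\<dots> = (U ** diag_matrix \<mu>) $ i $ j"
      by (simp add: matrix_matrix_mult_def diag_matrix_def if_distrib cong: if_cong)
    finally show "(?S ** U) $ i $ j = (U ** diag_matrix \<mu>) $ i $ j" .
  qed
  have XtX: "transpose X ** X = transpose R ** (?D ** ?D) ** R"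
  proof -
    have "transpose X ** X = transpose R ** ?D ** (transpose U ** U) ** ?D ** R"
      by (simp add: X matrix_transpose_mul diag_matrix_simps(4) matrix_mul_assoc)
    then show ?thesis by (simp add: U matrix_mul_assoc)
  qed
  have "?S ** X = U ** (diag_matrix \<mu> ** ?D) ** R" by (simp add: X SUM matrix_mul_assoc)
  \<comment> \<open>Either \<open>d i\<close> vanishes or its square is \<open>\<mu> i - s\<close>;
    in both cases \<open>\<mu> i * d i\<close> is the cube of \<open>d i\<close> plus
    \<open>s * d i\<close>.\<close>
  also have "diag_matrix \<mu> ** ?D = ?D ** ?D ** ?D + s *\<^sub>R ?D"
  proof -
    have "\<mu> i * d i = d i * d i * d i + s * d i" for i
      using l[of i] by (auto simp: dd algebra_simps) (simp_all add: d_def)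
    then show ?thesis by (simp add: diag_matrix_simps)
  qed
  also have "U ** (?D ** ?D ** ?D + s *\<^sub>R ?D) ** R = X ** (transpose X ** X) + s *\<^sub>R X"
  proof -
    have "X ** (transpose X ** X) = U ** ?D ** (R ** transpose R) ** (?D ** ?D) ** R"
      by (simp add: XtX) (simp add: X matrix_mul_assoc)
    then show ?thesis by (simp add: R X matrix_mult_linear_simps matrix_mul_assoc)
  qed
  also have "\<dots> = gp_cov X s ** X"
    by (simp add: gp_cov_def matrix_mult_linear_simps matrix_mul_assoc)
      (subst mat_eq_scaleR, simp add: matrix_mult_linear_simps)
  finally have SX: "?S ** X = gp_cov X s ** X" .
  let ?r = "retained s l"
  have r: "card ?r < CARD('n)"
    using card_mono[of "UNIV :: 'q set" ?r] card by simp
  have "trace (X ** transpose X) = trace (transpose X ** X)" by (rule trace_mul_sym)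
  also have "\<dots> = trace ((R ** transpose R) ** (?D ** ?D))"
    unfolding XtX by (metis matrix_mul_assoc trace_mul_sym)
  also have "\<dots> = (\<Sum>i\<in>UNIV. l i - s)" by (simp add: R diag_matrix_simps dd)
  also have "\<dots> = (\<Sum>i\<in>?r. l i - s)"
    by (rule sum.mono_neutral_right) (auto simp: retained_def)
  finally have "trace (gp_cov X s) = (\<Sum>i\<in>?r. l i) + s * (real CARD('n) - real (card ?r))"
    by (simp add: gp_cov_def trace_add mat_eq_scaleR[of s] trace_scaleR trace_I sum_subtractf algebra_simps)
  also have "(\<Sum>i\<in>?r. l i) = (\<Sum>i\<in>?r. \<nu> (\<pi> i))" using \<pi>(2) by simp
  also have "\<dots> = (\<Sum>j=1..card ?r. \<nu> j)" by (rule sum.reindex_bij_betw[OF \<pi>(1)])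
  \<comment> \<open>Here the maximum likelihood value enters: \<open>s\<close> is the mean of the
    discarded eigenvalues, so the noise contributes exactly their sum. The strict bound
    \<open>r\<close> keeps the divisor nonzero.\<close>
  also have "s * (real CARD('n) - real (card ?r)) = (\<Sum>j=card ?r + 1..CARD('n). \<nu> j)"
    using r ml by (simp add: of_nat_diff field_simps)
  also have "(\<Sum>j=1..card ?r. \<nu> j) + (\<Sum>j=card ?r + 1..CARD('n). \<nu> j) = (\<Sum>j=1..CARD('n). \<nu> j)"
    using sum.ub_add_nat[of 1 "card ?r" \<nu> "CARD('n) - card ?r"] r by simp
  also have "\<dots> = trace ?S" by (rule lists_eigenvalues_trace[OF sample_cov_symmetric \<nu>, symmetric])
  finally show ?thesis using SX by (simp add: gp_critical_def)
qed

lemma local_max_fst: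
  assumes "local_max (\<lambda>(x, y). f x y) (x, y)"
  shows "local_max (\<lambda>x. f x y) x"
proof -
  have "((\<lambda>x. (x, y)) \<longlongrightarrow> (x, y)) (nhds x)" by (intro tendsto_Pair filterlim_ident tendsto_const)
  from local_max_along[OF assms this] show ?thesis by (simp add: local_max_def)
qed

lemma local_max_imp_stationary:
  fixes f :: "'a::real_normed_vector \<Rightarrow> real"
  assumes "local_max f p" "(f has_derivative f') (at p)"
  shows "stationary_point f p"
proof -
  have "\<forall>\<^sub>F x in at p. f x \<le> f p"
    using assms(1) unfolding local_max_def eventually_at_filter by (rule eventually_mono) simp
  then have "f' = (\<lambda>_. 0)" by (rule has_derivative_local_max[OF assms(2)])
  with assms(2) show ?thesis by (simp add: stationary_point_def)
qed

text \<open>A critical point is never a local minimum, so if it is not a saddle it is a joint local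
  maximum, hence a local maximum in \<open>X\<close>. For an arbitrary joint local maximum,
  criticality comes from the vanishing derivative in place of the parametrised form.\<close>

theorem proposition3p2:
  fixes Y :: "real^'m^'n"
  assumes "CARD('q::finite) < CARD('n)"
  shows "(\<forall>(X :: real^'q^'n) s. ml_stationary_point Y X s \<longrightarrow>
            saddle_point (\<lambda>(X, s). log_marginal Y X s) (X, s) \<or> global_max Y X s) \<and>
         (\<forall>(X :: real^'q^'n) s. ml_stationary_point Y X s \<and> local_max (\<lambda>X. log_marginal Y X s) X \<longrightarrow>
            global_max Y X s) \<and>
         (\<forall>(X :: real^'q^'n) s. s > 0 \<and> local_max (\<lambda>(X, s). log_marginal Y X s) (X, s) \<longrightarrow>
            global_max Y X s)"
proof (intro conjI allI impI; (elim conjE)?)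
  fix X :: "real^'q^'n" and s
  {
    assume ml: "ml_stationary_point Y X s"
    then have s: "s > 0" by (simp add: ml_stationary_point_def)
    have crit: "gp_critical (sample_cov Y) X s"
      by (rule ml_stationary_point_imp_critical[OF ml assms])
    show "saddle_point (\<lambda>(X, s). log_marginal Y X s) (X, s) \<or> global_max Y X s"
      using gp_critical_iff_stationary[OF s] gp_critical_not_local_min[OF crit s] crit
        critical_local_max_imp_global_max[OF s crit] local_max_fst[of "log_marginal Y" X s]
      unfolding saddle_point_def by blast
    show "global_max Y X s" if "local_max (\<lambda>X. log_marginal Y X s) X"
      using critical_local_max_imp_global_max[OF s crit that] .
  next
    assume s: "s > 0" and max: "local_max (\<lambda>(X, s). log_marginal Y X s) (X, s)"
    have "gp_critical (sample_cov Y) X s"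
      unfolding gp_critical_iff_stationary[OF s]
      by (rule local_max_imp_stationary[OF max has_derivative_log_marginal[OF s]])
    then show "global_max Y X s"
      using critical_local_max_imp_global_max[OF s] local_max_fst[of "log_marginal Y", OF max] by blast
  }
qed

end
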